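(* Let $s,t,p\ge1$ with $t\ge s$ and $t\ge p$, $A,B\in GL(n)$, $Q\in\mathcal{P}(n)$, and consider $$Y^{s/t}+A^*Y^{-1}A+B^*Y^{-p/t}B=Q.\qquad( ** )$$ Let $a=\lambda_n(AQ^{-1}A^* )$. Suppose there is a real $b>0$ such that, with $\theta=b^{-1}\lambda_n(A^*A)$: (i) $b>a$; (ii) $Q\ge b^{-1}A^*A+b^{s/t}I+a^{-p/t}B^*B$; (iii) $s\|A\|^2<\tfrac12 t\theta^2a^{1-s/t}$; (iv) $p\|B\|^2<s\,a^{(p+s)/t}$. Define $F(X,Y)=A\big(Q-X^{s/t}-B^*Y^{-p/t}B\big)^{-1}A^*$ for $X,Y\in[aI,bI]$. Then: (I) $( ** )$ has a unique Hermitian positive definite solution $\bar X\in[aI,bI]$ (i.e. unique $\bar X\in[aI,bI]$ with $F(\bar X,\bar X)=\bar X$); (II) $\bar X\in[F(aI,bI),F(bI,aI)]$; (III) the sequences $X_0=aI$, $Y_0=bI$, $X_{n+1}=A(Q-X_n^{s/t}-B^*Y_n^{-p/t}B)^{-1}A^*$, $Y_{n+1}=A(Q-Y_n^{s/t}-B^*X_n^{-p/t}B)^{-1}A^*$ both converge to $\bar X$, and $$\max\{\|X_n-\bar X\|,\|Y_n-\bar X\|\}\le\frac{\delta^n}{1-\delta}\max\{\|X_1-X_0\|,\|Y_1-Y_0\|\},$$ where $\delta=2\max\big\{\tfrac st\|A\|^2\theta^{-2}a^{\frac st-1},\ \tfrac pt\|A\|^2\|B\|^2\theta^{-2}a^{-\frac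 pt-1}\big\}<1$. Consequently the equation $X^s+A^*X^{-t}A+B^*X^{-p}B=Q$ has a unique Hermitian positive definite solution $\bar X^{1/t}$ in $[a^{1/t}I,b^{1/t}I]$.
   Context: $GL(n)$: $n\times n$ complex nonsingular matrices; $\mathcal{P}(n)$: $n\times n$ Hermitian positive definite matrices. For Hermitian $M$, $\lambda_n(M)$ is its smallest eigenvalue. $\|\cdot\|$ is the spectral norm. For Hermitian $P,R$, $P\le R$ means $R-P$ is positive semidefinite, and $[P,R]=\{X \text{ Hermitian}: P\le X\le R\}$. Real powers of positive definite matrices are defined by functional calculus. *)

theory Defs
  imports "HOL-Analysis.Analysis"
begin

definition adj :: "complex^'n^'n \<Rightarrow> complex^'n^'n" where
  "adj M = (\<chi> i j. cnj (M $ j $ i))"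

definition hermitian :: "complex^'n^'n \<Rightarrow> bool" where
  "hermitian M \<longleftrightarrow> adj M = M"

definition unitary :: "complex^'n^'n \<Rightarrow> bool" where
  "unitary U \<longleftrightarrow> U ** adj U = mat 1 \<and> adj U ** U = mat 1"

definition qform :: "complex^'n^'n \<Rightarrow> complex^'n \<Rightarrow> complex" where
  "qform M x = (\<Sum>i\<in>UNIV. cnj (x $ i) * (M *v x) $ i)"

definition psd :: "complex^'n^'n \<Rightarrow> bool" where
  "psd M \<longleftrightarrow> hermitian M \<and> (\<forall>x. 0 \<le> Re (qform M x))"

definition posdef :: "complex^'n^'n \<Rightarrow> bool" where
  "posdef M \<longleftrightarrow> hermitian M \<and> (\<forall>x. x \<noteq> 0 \<longrightarrow> 0 < Re (qform M x))"

definition loewner_le :: "complex^'n^'n \<Rightarrow> complex^'n^'n \<Rightarrow> bool" where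
  "loewner_le P R \<longleftrightarrow> psd (R - P)"

definition loewner_interval :: "complex^'n^'n \<Rightarrow> complex^'n^'n \<Rightarrow> (complex^'n^'n) set" where
  "loewner_interval P R = {X. hermitian X \<and> loewner_le P X \<and> loewner_le X R}"

definition scal :: "real \<Rightarrow> complex^'n^'n" where
  "scal c = mat (complex_of_real c)"

definition cdiag :: "('n \<Rightarrow> real) \<Rightarrow> complex^'n^'n" where
  "cdiag d = (\<chi> i j. if i = j then complex_of_real (d i) else 0)"

definition mpow :: "complex^'n^'n \<Rightarrow> real \<Rightarrow> complex^'n^'n" where
  "mpow X r = (SOME Y. \<exists>U d. unitary U \<and> (\<forall>i. 0 < d i) \<and>
       X = U ** cdiag d ** adj U \<and> Y = U ** cdiag (\<lambda>i. d i powr r) ** adj U)"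

definition lambda_min :: "complex^'n^'n \<Rightarrow> real" where
  "lambda_min M = Min {Re l | l. \<exists>v. v \<noteq> 0 \<and> M *v v = l *s v}"

definition specnorm :: "complex^'n^'n \<Rightarrow> real" where
  "specnorm M = onorm (\<lambda>x. M *v x)"

fun pair_iter :: "('m \<Rightarrow> 'm \<Rightarrow> 'm) \<Rightarrow> 'm \<Rightarrow> 'm \<Rightarrow> nat \<Rightarrow> 'm \<times> 'm" where
  "pair_iter F x0 y0 0 = (x0, y0)"
| "pair_iter F x0 y0 (Suc k) = (F (fst (pair_iter F x0 y0 k)) (snd (pair_iter F x0 y0 k)),
                                F (snd (pair_iter F x0 y0 k)) (fst (pair_iter F x0 y0 k)))"

end

theory Submission
  imports Defs
begin

text \<open>
  Write \<open>G X Y = Q - X powr (s/t) - B* Y powr (-p/t) B\<close>. On \<open>[a, b]\<close> scalar functional calculus and (ii) give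
  \<open>b\<inverse> A*A \<le> G X Y \<le> Q\<close>, so \<open>F X Y = A (G X Y)\<inverse> A*\<close> maps \<open>[a, b] \<times> [a, b]\<close> into \<open>[a, b]\<close>, and
  \<open>G X Y \<ge> \<theta>\<close> bounds its inverse. For \<open>X, Y \<ge> a\<close> and \<open>-1 \<le> r \<le> 1\<close> one has
  \<open>\<parallel>X powr r - Y powr r\<parallel> \<le> \<bar>r\<bar> a powr (r-1) \<parallel>X - Y\<parallel>\<close>: with \<open>c = \<parallel>X - Y\<parallel>\<close> and \<open>r \<ge> 0\<close>, the
  Loewner-Heinz inequality turns \<open>Y \<le> X + c\<close> into \<open>Y powr r \<le> (X + c) powr r\<close>, and the right-hand side is
  controlled by the mean value theorem because \<open>X\<close> and \<open>X + c\<close> commute; negative \<open>r\<close> is the same with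
  the inequalities reversed. Hence \<open>(X, Y) \<mapsto> (F X Y, F Y X)\<close> is a \<open>\<delta>\<close>-contraction for the maximum of
  the spectral norms, and its unique fixed point is symmetric.
\<close>

section \<open>Spectral theorem for Hermitian matrices\<close>

lemma matrix_diff_rdistrib: "((B::complex^'n^'n) - C) ** A = B ** A - C ** A"
  by (simp add: matrix_matrix_mult_def vec_eq_iff sum_subtractf left_diff_distrib)

lemma matrix_diff_ldistrib: "(A::complex^'n^'n) ** (B - C) = A ** B - A ** C"
  by (simp add: matrix_matrix_mult_def vec_eq_iff sum_subtractf right_diff_distrib)

lemma adj_adj [simp]: "adj (adj M) = M"
  by (simp add: adj_def vec_eq_iff)

lemma adj_mult: "adj (M ** N) = adj N ** adj M"
  by (simp add: adj_def vec_eq_iff matrix_matrix_mult_def mult.commute)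

lemma adj_add: "adj (M + N) = adj M + adj N"
  by (simp add: adj_def vec_eq_iff)

lemma adj_diff: "adj (M - N) = adj M - adj N"
  by (simp add: adj_def vec_eq_iff)

lemma adj_cdiag [simp]: "adj (cdiag d) = cdiag d"
  by (auto simp: adj_def cdiag_def vec_eq_iff)

lemma adj_scal [simp]: "adj (scal c) = scal c"
  by (auto simp: adj_def scal_def mat_def vec_eq_iff)

lemma adj_mat_1 [simp]: "adj (mat 1) = mat 1"
  by (auto simp: adj_def mat_def vec_eq_iff)

lemma hermitian_add: "hermitian M \<Longrightarrow> hermitian N \<Longrightarrow> hermitian (M + N)"
  by (simp add: hermitian_def adj_add)

lemma hermitian_diff: "hermitian M \<Longrightarrow> hermitian N \<Longrightarrow> hermitian (M - N)"
  by (simp add: hermitian_def adj_diff)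

lemma hermitian_scal [simp]: "hermitian (scal c)"
  by (simp add: hermitian_def)

lemma hermitian_sandwich: "hermitian M \<Longrightarrow> hermitian (C ** M ** adj C)"
  by (simp add: hermitian_def adj_mult matrix_mul_assoc)

lemma scal_mult_vec: "scal c *v x = c *\<^sub>R x"
  by (simp add: scal_def mat_def matrix_vector_mult_def vec_eq_iff
      if_distrib[of "\<lambda>u. u * _"] cong: if_cong) (simp add: scaleR_conv_of_real)

text \<open>Definiteness only involves the real part of the sesquilinear form, so it can be argued
  in the real Euclidean structure of \<open>complex^'n\<close>.\<close>

lemma inner_complex_vec: "inner (x::complex^'n) y = Re (\<Sum>i\<in>UNIV. cnj (x $ i) * y $ i)"
  by (simp add: inner_vec_def inner_complex_def)

lemma Re_qform: "Re (qform M x) = x \<bullet> (M *v x)"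
  by (simp add: qform_def inner_complex_vec)

lemma inner_matrix_right: "x \<bullet> (M *v y) = (adj M *v x) \<bullet> (y::complex^'n)"
proof -
  have "(\<Sum>i\<in>UNIV. cnj (x $ i) * (M *v y) $ i) = (\<Sum>i\<in>UNIV. \<Sum>j\<in>UNIV. cnj (x $ i) * M $ i $ j * y $ j)"
    by (simp add: matrix_vector_mult_def sum_distrib_left mult.assoc)
  also have "\<dots> = (\<Sum>j\<in>UNIV. \<Sum>i\<in>UNIV. cnj (x $ i) * M $ i $ j * y $ j)"
    by (rule sum.swap)
  also have "\<dots> = (\<Sum>j\<in>UNIV. cnj ((adj M *v x) $ j) * y $ j)"
    by (simp add: matrix_vector_mult_def adj_def sum_distrib_right sum_distrib_left mult_ac)
  finally show ?thesis by (simp add: inner_complex_vec)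
qed

lemma inner_matrix_left: "(M *v x) \<bullet> y = x \<bullet> (adj M *v (y::complex^'n))"
  by (metis inner_matrix_right adj_adj)

lemma hermitian_inner: "hermitian M \<Longrightarrow> x \<bullet> (M *v y) = (M *v x) \<bullet> y"
  by (simp add: inner_matrix_right hermitian_def)

lemma psd_iff: "psd M \<longleftrightarrow> hermitian M \<and> (\<forall>x. 0 \<le> x \<bullet> (M *v x))"
  by (simp add: psd_def Re_qform)

lemma posdef_iff: "posdef M \<longleftrightarrow> hermitian M \<and> (\<forall>x. x \<noteq> 0 \<longrightarrow> 0 < x \<bullet> (M *v x))"
  by (simp add: posdef_def Re_qform)

lemma matrix_vector_scaleR: "(M::complex^'n^'m) *v (c *\<^sub>R x) = c *\<^sub>R (M *v x)"
  using linear_scale[OF matrix_vector_mul_linear] .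

text \<open>A maximiser of the quadratic form on the compact unit sphere of \<open>V\<close> is an
  eigenvector. \<open>V\<close> is a real subspace, because the complements to which this is applied
  are taken for the real inner product.\<close>

lemma hermitian_eigenvector_in_invariant_subspace:
  fixes M :: "complex^'n^'n"
  assumes M: "hermitian M" and V: "subspace V" and inv: "\<And>x. x \<in> V \<Longrightarrow> M *v x \<in> V"
    and z: "z \<in> V" "z \<noteq> 0"
  obtains v l where "v \<in> V" "norm v = 1" "M *v v = l *\<^sub>R v"
proof -
  let ?K = "V \<inter> sphere 0 1"
  have "compact ?K"
    by (simp add: V closed_Int_compact closed_subspace)
  moreover have "(1 / norm z) *\<^sub>R z \<in> ?K"
    using z V by (auto intro: subspace_scale)
  moreover have "continuous_on ?K (\<lambda>x. x \<bullet> (M *v x))"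
    by (intro continuous_intros linear_continuous_on matrix_vector_mul_bounded_linear)
  ultimately obtain v where v: "v \<in> ?K" and max: "\<And>y. y \<in> ?K \<Longrightarrow> y \<bullet> (M *v y) \<le> v \<bullet> (M *v v)"
    using continuous_attains_sup[of ?K "\<lambda>x. x \<bullet> (M *v x)"] by blast
  define l where "l = v \<bullet> (M *v v)"
  have max': "y \<bullet> (M *v y) \<le> l * (y \<bullet> y)" if "y \<in> V" for y
  proof (cases "y = 0")
    case False
    then have "(1 / norm y) *\<^sub>R y \<in> ?K"
      using that V by (auto intro: subspace_scale)
    from max[OF this] have "(1 / norm y) * ((1 / norm y) * (y \<bullet> (M *v y))) \<le> l"
      by (simp add: l_def matrix_vector_scaleR)
    then show ?thesis using False
      by (simp add: field_simps power2_norm_eq_inner[symmetric] power2_eq_square)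
  qed auto
  define w where "w = M *v v - l *\<^sub>R v"
  have vv: "v \<bullet> v = 1" "v \<in> V" using v by (auto simp: norm_eq_1)
  have wV: "w \<in> V" unfolding w_def using vv V inv by (auto intro: subspace_diff subspace_scale)
  have "v \<bullet> w = 0"
    by (simp add: w_def inner_diff_right vv l_def)
  then have wv: "w \<bullet> v = 0" by (simp add: inner_commute)
  have ww: "w \<bullet> (M *v v) = w \<bullet> w"
    using wv by (simp add: w_def inner_diff_right)
  have ww': "v \<bullet> (M *v w) = w \<bullet> w"
    using hermitian_inner[OF M] ww by (simp add: inner_commute)
  \<comment> \<open>Maximality tested at \<open>v + e *\<^sub>R w\<close>: the constant terms cancel
    and a term linear in \<open>e\<close> is bounded by a quadratic one, which forces the residual
    \<open>w\<close> to vanish.\<close>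
  have *: "2 * e * (w \<bullet> w) \<le> e\<^sup>2 * (l * (w \<bullet> w) - w \<bullet> (M *v w))" for e
  proof -
    have "v + e *\<^sub>R w \<in> V" using vv wV V by (auto intro: subspace_add subspace_scale)
    from max'[OF this] show ?thesis
      using wv vv ww ww'
      by (simp add: algebra_simps inner_add_left inner_add_right matrix_vector_scaleR
          matrix_vector_right_distrib l_def[symmetric] inner_commute power2_eq_square)
  qed
  define K where "K = l * (w \<bullet> w) - w \<bullet> (M *v w)"
  have "w \<bullet> w = 0"
  proof (rule ccontr)
    assume "w \<bullet> w \<noteq> 0"
    then have pos: "w \<bullet> w > 0" by (metis inner_gt_zero_iff inner_eq_zero_iff)
    show False
    proof (cases "K \<le> 0")
      case True
      then show False using *[of 1] pos by (simp add: K_def[symmetric])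
    next
      case False
      \<comment> \<open>At this \<open>e\<close> the two sides of the inequality are 2 and 1 times
        the same positive number.\<close>
      with *[of "w \<bullet> w / K"] have "2 * (w \<bullet> w) * (w \<bullet> w) \<le> (w \<bullet> w) * (w \<bullet> w)"
        by (simp add: K_def[symmetric] power2_eq_square divide_le_cancel)
      then show False using mult_pos_pos[OF pos pos] by linarith
    qed
  qed
  then have "M *v v = l *\<^sub>R v" by (simp add: w_def)
  with vv v that show thesis by auto
qed

text \<open>Orthogonality to both \<open>w\<close> and \<open>\<i> *s w\<close> is complex
  orthogonality. The vectors found so far and their multiples by \<open>\<i>\<close> span a real
  space of dimension at most \<open>2 * k\<close>, less than \<open>2 * CARD('n)\<close>; its
  complement is nonzero and \<open>M\<close>-invariant, and so contains the next
  eigenvector.\<close>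

lemma hermitian_orthonormal_eigenvectors:
  fixes M :: "complex^'n^'n"
  assumes M: "hermitian M"
  shows "k \<le> CARD('n) \<Longrightarrow> \<exists>S. finite S \<and> card S = k \<and>
    (\<forall>v\<in>S. norm v = 1 \<and> (\<exists>l::real. M *v v = l *\<^sub>R v)) \<and>
    (\<forall>v\<in>S. \<forall>w\<in>S. v \<noteq> w \<longrightarrow> v \<bullet> w = 0 \<and> v \<bullet> (\<i> *s w) = 0)"
proof (induction k)
  case 0
  then show ?case by (intro exI[of _ "{}"]) auto
next
  case (Suc k)
  then obtain S where S: "finite S" "card S = k"
    and ev: "\<And>v. v \<in> S \<Longrightarrow> norm v = 1 \<and> (\<exists>l::real. M *v v = l *\<^sub>R v)"
    and orth: "\<And>v w. v \<in> S \<Longrightarrow> w \<in> S \<Longrightarrow> v \<noteq> w \<Longrightarrow> v \<bullet> w = 0 \<and> v \<bullet> (\<i> *s w) = 0"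
    by (metis Suc_leD)
  let ?T = "S \<union> (\<lambda>v. \<i> *s v) ` S"
  define V where "V = {x. \<forall>v\<in>?T. x \<bullet> v = 0}"
  have V: "subspace V"
    by (auto simp: V_def subspace_def inner_add_left)
  have "dim ?T \<le> card ?T" by (rule dim_le_card') (use S in auto)
  also have "\<dots> \<le> k + k"
    using card_Un_le[of S "(\<lambda>v. \<i> *s v) ` S"] card_image_le[OF S(1), of "\<lambda>v. \<i> *s v"] S(2) by linarith
  also have "\<dots> < DIM(complex^'n)" using Suc.prems by simp
  finally obtain z where z: "z \<noteq> 0" "\<And>y. y \<in> span ?T \<Longrightarrow> orthogonal z y"
    using orthogonal_to_subspace_exists by blast
  then have zV: "z \<in> V" by (auto simp: V_def orthogonal_def span_base)
  have inv: "M *v x \<in> V" if "x \<in> V" for x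
  proof -
    have "(M *v x) \<bullet> v = 0 \<and> (M *v x) \<bullet> (\<i> *s v) = 0" if "v \<in> S" for v
    proof -
      obtain l :: real where l: "M *v v = l *\<^sub>R v" using ev \<open>v \<in> S\<close> by blast
      have "M *v (\<i> *s v) = \<i> *s (M *v v)" by (rule vector_scalar_commute)
      also have "\<dots> = l *\<^sub>R (\<i> *s v)" using l by (simp add: vec_eq_iff)
      finally show ?thesis using l \<open>x \<in> V\<close> \<open>v \<in> S\<close>
        by (auto simp: hermitian_inner[OF M, symmetric] V_def)
    qed
    then show ?thesis by (auto simp: V_def)
  qed
  obtain v l where v: "v \<in> V" "norm v = 1" "M *v v = l *\<^sub>R v"
    using hermitian_eigenvector_in_invariant_subspace[OF M V inv zV z(1)] by blast
  \<comment> \<open>Skew symmetry carries the orthogonality of the new vector to the old ones over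
    to the opposite order of arguments.\<close>
  have flip: "x \<bullet> (\<i> *s y) = - (y \<bullet> (\<i> *s x))" for x y :: "complex^'n"
    by (simp add: inner_vec_def inner_complex_def sum_negf[symmetric] algebra_simps)
  have "v \<notin> S"
    using v by (auto simp: V_def norm_eq_1)
  moreover have "v \<bullet> w = 0 \<and> v \<bullet> (\<i> *s w) = 0 \<and> w \<bullet> v = 0 \<and> w \<bullet> (\<i> *s v) = 0" if "w \<in> S" for w
    using v(1) that by (auto simp: V_def flip[of w v] inner_commute[of w v])
  ultimately show ?case using S ev orth v
    by (intro exI[of _ "insert v S"]) auto
qed

theorem hermitian_spectral:
  fixes M :: "complex^'n^'n"
  assumes M: "hermitian M"
  obtains U d where "unitary U" "M = U ** cdiag d ** adj U"
proof -
  obtain S where S: "finite S" "card S = CARD('n)"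
    and ev: "\<And>v. v \<in> S \<Longrightarrow> norm v = 1 \<and> (\<exists>l::real. M *v v = l *\<^sub>R v)"
    and orth: "\<And>v w. v \<in> S \<Longrightarrow> w \<in> S \<Longrightarrow> v \<noteq> w \<Longrightarrow> v \<bullet> w = 0 \<and> v \<bullet> (\<i> *s w) = 0"
    using hermitian_orthonormal_eigenvectors[OF M order_refl] by blast
  obtain f where f: "bij_betw f (UNIV::'n set) S"
    using S by (metis finite_same_card_bij finite_class.finite_UNIV)
  then have fS: "f i \<in> S" for i by (auto simp: bij_betw_def)
  have finj: "f i = f j \<longleftrightarrow> i = j" for i j
    using f by (auto simp: bij_betw_def inj_on_def)
  have "\<forall>i. \<exists>l::real. M *v f i = l *\<^sub>R f i"
    using ev[OF fS] by blast
  from choice[OF this] obtain d where d: "\<And>i. M *v f i = (d i::real) *\<^sub>R f i"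
    by blast
  define U where "U = (\<chi> i j. f j $ i)"
  have ip: "(\<Sum>k\<in>UNIV. cnj (f i $ k) * f j $ k) = (if i = j then 1 else 0)" for i j
  proof -
    have re: "Re (\<Sum>k\<in>UNIV. cnj (f i $ k) * f j $ k) = f i \<bullet> f j"
      by (simp add: inner_complex_vec)
    \<comment> \<open>The second orthogonality relation is the vanishing of this imaginary part, so
      both together give complex orthonormality.\<close>
    have im: "Im (\<Sum>k\<in>UNIV. cnj (f i $ k) * f j $ k) = - (f i \<bullet> (\<i> *s f j))"
      by (simp add: inner_vec_def inner_complex_def sum_negf[symmetric] algebra_simps)
    have self: "f i \<bullet> (\<i> *s f i) = 0"
      by (simp add: inner_vec_def inner_complex_def)
    show ?thesis
      using re im self orth[OF fS fS, of i j] ev[OF fS, of i] finj[of i j]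
      by (cases "i = j") (auto simp: complex_eq_iff norm_eq_1)
  qed
  have 1: "adj U ** U = mat 1"
    using ip by (simp add: U_def adj_def matrix_matrix_mult_def mat_def vec_eq_iff)
  then have 2: "U ** adj U = mat 1" by (simp add: matrix_left_right_inverse)
  have "M ** U = U ** cdiag d"
  proof -
    have "(M ** U) $ i $ j = (U ** cdiag d) $ i $ j" for i j
    proof -
      have "(M ** U) $ i $ j = (M *v f j) $ i"
        by (simp add: matrix_matrix_mult_def matrix_vector_mult_def U_def)
      also have "\<dots> = d j * f j $ i" by (simp add: d) (simp add: scaleR_conv_of_real)
      also have "\<dots> = (U ** cdiag d) $ i $ j"
        by (simp add: matrix_matrix_mult_def cdiag_def U_def if_distrib[of "\<lambda>u. _ * u"] cong: if_cong)
      finally show ?thesis .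
    qed
    then show ?thesis by (simp add: vec_eq_iff)
  qed
  then have "M = U ** cdiag d ** adj U"
    by (metis 2 matrix_mul_assoc matrix_mul_rid)
  with 1 2 that show thesis by (simp add: unitary_def)
qed

section \<open>Functional calculus and the Loewner order\<close>

definition udiag :: "complex^'n^'n \<Rightarrow> ('n \<Rightarrow> real) \<Rightarrow> complex^'n^'n" where
  "udiag U d = U ** cdiag d ** adj U"

lemma cdiag_mult_vec: "cdiag d *v x = (\<chi> i. d i *\<^sub>R x $ i)"
  by (simp add: cdiag_def matrix_vector_mult_def vec_eq_iff
      if_distrib[of "\<lambda>u. u * _"] cong: if_cong) (simp add: scaleR_conv_of_real)

lemma cdiag_mult: "cdiag d ** cdiag e = cdiag (\<lambda>i. d i * e i)"
  by (simp add: matrix_eq matrix_vector_mul_assoc[symmetric] cdiag_mult_vec)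

lemma cdiag_const: "cdiag (\<lambda>_. c) = scal c"
  by (simp add: cdiag_def scal_def mat_def)

lemma scal_commute: "M ** scal c = scal c ** M"
  by (simp add: matrix_eq matrix_vector_mul_assoc[symmetric] scal_mult_vec matrix_vector_scaleR)

lemma unitary_adj_cancel:
  assumes "unitary U"
  shows "adj U ** (U ** X) = X" "U ** (adj U ** X) = X"
    "adj U *v (U *v x) = x" "U *v (adj U *v x) = x"
  using assms
  by (simp_all add: unitary_def matrix_mul_assoc matrix_vector_mul_assoc)

lemma hermitian_udiag [simp]: "hermitian (udiag U d)"
  by (simp add: udiag_def hermitian_sandwich hermitian_def[of "cdiag d"])

lemma udiag_mult: "unitary U \<Longrightarrow> udiag U d ** udiag U e = udiag U (\<lambda>i. d i * e i)"
  unfolding udiag_def cdiag_mult[symmetric]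
  by (simp add: matrix_mul_assoc[symmetric] unitary_adj_cancel)

lemma udiag_diff: "udiag U d - udiag U e = udiag U (\<lambda>i. d i - e i)"
proof -
  have "cdiag d - cdiag e = cdiag (\<lambda>i. d i - e i)"
    by (auto simp: cdiag_def vec_eq_iff)
  then show ?thesis
    by (simp add: udiag_def flip: matrix_diff_ldistrib matrix_diff_rdistrib)
qed

lemma udiag_add: "udiag U d + udiag U e = udiag U (\<lambda>i. d i + e i)"
  using udiag_diff[of U "\<lambda>i. d i + e i" e] unfolding diff_eq_eq by simp

text \<open>Scalar matrices are diagonal in every orthonormal basis, so comparing
  \<open>udiag U d\<close> with \<open>scal c\<close> becomes a comparison of numbers.\<close>

lemma udiag_const: "unitary U \<Longrightarrow> udiag U (\<lambda>_. c) = scal c"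
  unfolding udiag_def cdiag_const scal_commute unitary_def by (metis matrix_mul_assoc matrix_mul_rid)

lemma norm_unitary: "unitary U \<Longrightarrow> norm (adj U *v x) = norm x"
  unfolding norm_eq inner_matrix_left by (simp add: unitary_adj_cancel)

lemma inner_udiag: "x \<bullet> (udiag U d *v x) = (\<Sum>i\<in>UNIV. d i * (norm ((adj U *v x) $ i))\<^sup>2)"
proof -
  have "x \<bullet> (udiag U d *v x) = (adj U *v x) \<bullet> (cdiag d *v (adj U *v x))"
    by (simp add: udiag_def matrix_vector_mul_assoc[symmetric] inner_matrix_right[of x])
  then show ?thesis
    by (simp add: cdiag_mult_vec inner_vec_def power2_norm_eq_inner)
qed

lemma norm_power2_unitary: 
  assumes "unitary U" shows "(norm x)\<^sup>2 = (\<Sum>i\<in>UNIV. (norm ((adj U *v x) $ i))\<^sup>2)"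
  by (subst norm_unitary[OF assms, symmetric]) (simp add: norm_vec_def L2_set_def sum_nonneg)

text \<open>\<open>U *v axis i 1\<close> is the i-th column of \<open>U\<close>; as a test vector it
  recovers \<open>d i\<close> from the quadratic form.\<close>

lemma udiag_eigenvector:
  assumes "unitary U"
  shows "udiag U d *v (U *v axis i 1) = d i *\<^sub>R (U *v axis i 1)" "norm (U *v axis i 1) = 1"
proof -
  have "cdiag d *v axis i 1 = d i *\<^sub>R axis i 1"
    by (simp add: cdiag_mult_vec vec_eq_iff axis_def)
  then show "udiag U d *v (U *v axis i 1) = d i *\<^sub>R (U *v axis i 1)"
    by (simp add: udiag_def matrix_vector_mul_assoc[symmetric] unitary_adj_cancel assms matrix_vector_scaleR)
  have "norm (adj U *v (U *v axis i 1)) = 1"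
    by (simp add: unitary_adj_cancel assms norm_eq_1 inner_axis_axis)
  then show "norm (U *v axis i 1) = 1" by (simp only: norm_unitary assms)
qed

lemma inner_udiag_eigenvector:
  "unitary U \<Longrightarrow> (U *v axis i 1) \<bullet> (udiag U d *v (U *v axis i 1)) = d i"
  using udiag_eigenvector(2)[of U i] by (simp add: udiag_eigenvector(1) norm_eq_1)

lemma psd_udiag_iff:
  assumes "unitary U" shows "psd (udiag U d) \<longleftrightarrow> (\<forall>i. 0 \<le> d i)"
proof
  assume "psd (udiag U d)"
  then show "\<forall>i. 0 \<le> d i"
    unfolding psd_iff by (auto simp: inner_udiag_eigenvector[OF assms, of _ d, symmetric])
qed (simp add: psd_iff inner_udiag sum_nonneg)

lemma posdef_udiag_iff:
  assumes "unitary U" shows "posdef (udiag U d) \<longleftrightarrow> (\<forall>i. 0 < d i)"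
proof
  assume "posdef (udiag U d)"
  moreover have "U *v axis i 1 \<noteq> 0" for i
    using udiag_eigenvector(2)[OF assms, of i] by auto
  ultimately show "\<forall>i. 0 < d i"
    unfolding posdef_iff by (auto simp: inner_udiag_eigenvector[OF assms, of _ d, symmetric])
next
  assume d: "\<forall>i. 0 < d i"
  have "0 < x \<bullet> (udiag U d *v x)" if "x \<noteq> 0" for x
  proof -
    have "adj U *v x \<noteq> 0" using norm_unitary[OF assms, of x] that by auto
    then obtain i where "(adj U *v x) $ i \<noteq> 0" by (auto simp: vec_eq_iff)
    then have "0 < d i * (norm ((adj U *v x) $ i))\<^sup>2" using d by simp
    then show ?thesis unfolding inner_udiag
      using d by (intro sum_pos2[of _ i]) (auto simp: less_imp_le)
  qed
  then show "posdef (udiag U d)" by (simp add: posdef_iff)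
qed

lemma posdef_spectral:
  assumes "posdef X"
  obtains U d where "unitary U" "\<And>i. 0 < d i" "X = udiag U d"
proof -
  obtain U d where U: "unitary U" and X: "X = udiag U d"
    using assms hermitian_spectral[of X] unfolding posdef_def udiag_def by blast
  moreover have "0 < d i" for i
    using assms posdef_udiag_iff[OF U] unfolding X by blast
  ultimately show thesis using that by blast
qed

text \<open>The matrix \<open>V = adj W ** U\<close> intertwines the two diagonals, so its entry at
  \<open>i\<close>, \<open>j\<close> vanishes unless \<open>d j = e i\<close>; hence it also
  intertwines their images under \<open>f\<close>. This makes the choice in \<open>mpow\<close>
  independent of the diagonalisation.\<close>

lemma udiag_functional_calculus:
  assumes U: "unitary U" and W: "unitary W" and eq: "udiag U d = udiag W e"
  shows "udiag U (\<lambda>i. f (d i)) = udiag W (\<lambda>i. f (e i))"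
proof -
  define V where "V = adj W ** U"
  have R: "(V ** cdiag g) $ i $ j = V $ i $ j * g j" for g i j
    by (simp add: matrix_matrix_mult_def cdiag_def if_distrib[of "\<lambda>u. _ * u"] cong: if_cong)
  have L: "(cdiag g ** V) $ i $ j = g i * V $ i $ j" for g i j
    by (simp add: matrix_matrix_mult_def cdiag_def if_distrib[of "\<lambda>u. u * _"] cong: if_cong)
  have "V ** cdiag d = adj W ** udiag U d ** U"
    using U by (simp add: V_def udiag_def matrix_mul_assoc[symmetric] unitary_def)
  also have "\<dots> = cdiag e ** V"
    unfolding eq by (simp add: V_def udiag_def matrix_mul_assoc[symmetric] unitary_adj_cancel W)
  finally have eq': "V $ i $ j * d j = e i * V $ i $ j" for i j
    by (simp add: R[symmetric] L[symmetric])
  have "V $ i $ j * f (d j) = f (e i) * V $ i $ j" for i j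
    using eq'[of i j] by (cases "V $ i $ j = 0") auto
  then have *: "V ** cdiag (\<lambda>i. f (d i)) = cdiag (\<lambda>i. f (e i)) ** V"
    by (simp add: vec_eq_iff R L)
  have "udiag U (\<lambda>i. f (d i)) = W ** (V ** cdiag (\<lambda>i. f (d i))) ** adj U"
    by (simp add: V_def udiag_def matrix_mul_assoc[symmetric] unitary_adj_cancel W)
  also have "\<dots> = udiag W (\<lambda>i. f (e i))"
    unfolding * using U by (simp add: V_def udiag_def matrix_mul_assoc[symmetric] unitary_def)
  finally show ?thesis .
qed

section \<open>Real powers of positive definite matrices\<close>

lemma mpow_udiag:
  assumes U: "unitary U" and d: "\<And>i. 0 < d i"
  shows "mpow (udiag U d) r = udiag U (\<lambda>i. d i powr r)"
proof -
  let ?P = "\<lambda>Y. \<exists>W e. unitary W \<and> (\<forall>i. 0 < e i) \<and> udiag U d = W ** cdiag e ** adj W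
    \<and> Y = W ** cdiag (\<lambda>i. e i powr r) ** adj W"
  have "?P (udiag U (\<lambda>i. d i powr r))"
    using U d unfolding udiag_def by blast
  then have "?P (mpow (udiag U d) r)"
    unfolding mpow_def by (rule someI)
  then show ?thesis
    using udiag_functional_calculus[OF U, of _ d _ "\<lambda>u. u powr r"] by (auto simp: udiag_def)
qed

lemma posdef_mpow:
  assumes "posdef X" shows "posdef (mpow X r)"
proof -
  obtain U d where "unitary U" "\<And>i. 0 < d i" "X = udiag U d"
    using posdef_spectral[OF assms] by blast
  then show ?thesis by (simp add: mpow_udiag posdef_udiag_iff powr_gt_zero less_imp_neq[symmetric])
qed

lemma hermitian_mpow: "posdef X \<Longrightarrow> hermitian (mpow X r)"
  using posdef_mpow posdef_def by blast

lemma adj_mpow: "posdef X \<Longrightarrow> adj (mpow X r) = mpow X r"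
  using hermitian_mpow hermitian_def by blast

lemma mpow_add:
  assumes "posdef X" shows "mpow X (r + q) = mpow X r ** mpow X q"
proof -
  obtain U d where "unitary U" "\<And>i. 0 < d i" "X = udiag U d"
    using posdef_spectral[OF assms] by blast
  then show ?thesis by (simp add: mpow_udiag udiag_mult powr_add)
qed

lemma mpow_mpow:
  assumes "posdef X" shows "mpow (mpow X r) q = mpow X (r * q)"
proof -
  obtain U d where U: "unitary U" "\<And>i. 0 < d i" "X = udiag U d"
    using posdef_spectral[OF assms] by blast
  have "0 < d i powr r" for i using U(2)[of i] by simp
  with U show ?thesis by (simp add: mpow_udiag powr_powr)
qed

lemma mpow_1:
  assumes "posdef X" shows "mpow X 1 = X"
proof -
  obtain U d where "unitary U" "\<And>i. 0 < d i" "X = udiag U d"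
    using posdef_spectral[OF assms] by blast
  then show ?thesis by (simp add: mpow_udiag less_imp_le)
qed

lemma mpow_0:
  assumes "posdef X" shows "mpow X 0 = mat 1"
proof -
  obtain U d where U: "unitary U" "\<And>i. 0 < d i" "X = udiag U d"
    using posdef_spectral[OF assms] by blast
  have "d i \<noteq> 0" for i using U(2)[of i] by simp
  with U have "mpow X 0 = scal 1" by (simp add: mpow_udiag udiag_const)
  then show ?thesis by (simp add: scal_def)
qed

lemma mpow_scal: "0 < c \<Longrightarrow> mpow (scal c) r = scal (c powr r)"
  using mpow_udiag[of "mat 1" "\<lambda>_. c" r] by (simp add: udiag_const unitary_def)

lemma mpow_cancel:
  assumes "posdef X" shows "mpow X r ** mpow X (- r) = mat 1" "mpow X (- r) ** mpow X r = mat 1"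
  by (simp_all add: mpow_add[OF assms, symmetric] mpow_0[OF assms])

section \<open>Inverses as powers\<close>

lemma matrix_inv_eqI:
  fixes M :: "complex^'n^'n"
  assumes "M ** N = mat 1" shows "matrix_inv M = N"
proof -
  have NM: "N ** M = mat 1" using assms matrix_left_right_inverse by blast
  then have "M ** matrix_inv M = mat 1 \<and> matrix_inv M ** M = mat 1"
    unfolding matrix_inv_def using assms by (intro someI[of "\<lambda>A'. M ** A' = mat 1 \<and> A' ** M = mat 1" N]) auto
  then show ?thesis by (metis NM matrix_mul_assoc matrix_mul_lid matrix_mul_rid)
qed

lemma matrix_inv_cancel:
  fixes M :: "complex^'n^'n"
  assumes "invertible M" shows "M ** matrix_inv M = mat 1" "matrix_inv M ** M = mat 1"
  using assms matrix_inv_eqI[of M] unfolding invertible_def by auto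

lemma matrix_inv_posdef:
  assumes "posdef X" shows "matrix_inv X = mpow X (-1)"
  using mpow_cancel(1)[OF assms, of 1] by (intro matrix_inv_eqI) (simp add: mpow_1 assms)

lemma matrix_inv_mpow:
  assumes "posdef X" shows "matrix_inv (mpow X r) = mpow X (- r)"
  by (rule matrix_inv_eqI) (rule mpow_cancel[OF assms])

lemma posdef_invertible:
  assumes "posdef X" shows "invertible X"
  using mpow_cancel[OF assms, of 1] unfolding invertible_def mpow_1[OF assms] by blast

section \<open>The Loewner order and the smallest eigenvalue\<close>

lemma loewner_le_iff:
  assumes "hermitian P" "hermitian R"
  shows "loewner_le P R \<longleftrightarrow> (\<forall>x. x \<bullet> (P *v x) \<le> x \<bullet> (R *v x))"
  using assms
  by (simp add: loewner_le_def psd_iff hermitian_diff matrix_vector_mult_diff_rdistrib inner_diff_right)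

lemma loewner_le_scal_udiag:
  assumes "unitary U" shows "loewner_le (scal c) (udiag U d) \<longleftrightarrow> (\<forall>i. c \<le> d i)"
  by (simp add: loewner_le_def udiag_const[OF assms, symmetric] udiag_diff psd_udiag_iff[OF assms])

lemma loewner_le_udiag_scal:
  assumes "unitary U" shows "loewner_le (udiag U d) (scal c) \<longleftrightarrow> (\<forall>i. d i \<le> c)"
  by (simp add: loewner_le_def udiag_const[OF assms, symmetric] udiag_diff psd_udiag_iff[OF assms])

lemma posdef_mono:
  assumes "posdef P" "loewner_le P R" "hermitian R" shows "posdef R"
  using assms loewner_le_iff[of P R] unfolding posdef_iff by (auto intro: less_le_trans)

lemma posdef_scal: "0 < c \<Longrightarrow> posdef (scal c)"
  by (simp add: posdef_iff scal_mult_vec)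

text \<open>In an eigenbasis of \<open>X\<close> the scalar bounds say that all eigenvalues lie
  between \<open>a\<close> and \<open>b\<close>, so everything reduces to monotonicity of the real
  power function.\<close>

lemma mpow_scal_bounds:
  assumes X: "posdef X" and a: "0 < a" "loewner_le (scal a) X" and b: "loewner_le X (scal b)"
  shows "0 \<le> r \<Longrightarrow> loewner_le (scal (a powr r)) (mpow X r)"
    and "0 \<le> r \<Longrightarrow> loewner_le (mpow X r) (scal (b powr r))"
    and "r \<le> 0 \<Longrightarrow> loewner_le (scal (b powr r)) (mpow X r)"
    and "r \<le> 0 \<Longrightarrow> loewner_le (mpow X r) (scal (a powr r))"
proof -
  obtain U d where U: "unitary U" and d: "\<And>i. 0 < d i" and X: "X = udiag U d"
    using posdef_spectral[OF X] by blast
  have ab: "a \<le> d i" "d i \<le> b" for i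
    using a b unfolding X loewner_le_scal_udiag[OF U] loewner_le_udiag_scal[OF U] by auto
  note simps = X mpow_udiag[OF U d] loewner_le_scal_udiag[OF U] loewner_le_udiag_scal[OF U]
  show "0 \<le> r \<Longrightarrow> loewner_le (scal (a powr r)) (mpow X r)"
    unfolding simps using a(1) d ab by (meson powr_mono2 less_imp_le)
  show "0 \<le> r \<Longrightarrow> loewner_le (mpow X r) (scal (b powr r))"
    unfolding simps using a(1) d ab by (meson powr_mono2 less_imp_le)
  show "r \<le> 0 \<Longrightarrow> loewner_le (scal (b powr r)) (mpow X r)"
    unfolding simps using a(1) d ab by (auto intro!: powr_mono2')
  show "r \<le> 0 \<Longrightarrow> loewner_le (mpow X r) (scal (a powr r))"
    unfolding simps using a(1) d ab by (auto intro!: powr_mono2')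
qed

text \<open>Read in the coordinates \<open>adj U *v v\<close>, an eigenvector has a nonzero
  component, and there the eigenvalue must equal some \<open>d i\<close>. So the set in
  \<open>lambda_min\<close> is finite and nonempty, and its \<open>Min\<close> is a true
  minimum.\<close>

lemma lambda_min_udiag:
  assumes U: "unitary U" shows "lambda_min (udiag U d) = Min (range d)"
proof -
  have "{Re l | l. \<exists>v. v \<noteq> 0 \<and> udiag U d *v v = l *s v} = range d" (is "?E = _")
  proof (intro equalityI subsetI)
    fix r assume "r \<in> ?E"
    then obtain l v where r: "r = Re l" and v: "v \<noteq> 0" "udiag U d *v v = l *s v" by auto
    let ?w = "adj U *v v"
    have "cdiag d *v ?w = adj U *v (udiag U d *v v)"
      by (simp add: udiag_def matrix_vector_mul_assoc[symmetric] unitary_adj_cancel U)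
    also have "\<dots> = l *s ?w" unfolding v by (rule vector_scalar_commute)
    finally have eq: "d i *\<^sub>R ?w $ i = l * ?w $ i" for i
      by (simp add: cdiag_mult_vec vec_eq_iff)
    have "?w \<noteq> 0" using norm_unitary[OF U, of v] v by auto
    then obtain i where "?w $ i \<noteq> 0" by (auto simp: vec_eq_iff)
    with eq[of i] have "l = d i" by (auto simp: scaleR_conv_of_real)
    with r show "r \<in> range d" by simp
  next
    fix r assume "r \<in> range d"
    then obtain i where r: "r = d i" by auto
    let ?v = "U *v axis i 1"
    have "?v \<noteq> 0" using udiag_eigenvector(2)[OF U, of i] by auto
    moreover have "udiag U d *v ?v = complex_of_real r *s ?v"
      using udiag_eigenvector(1)[OF U, of d i] by (simp add: r vec_eq_iff scaleR_conv_of_real[where 'a=complex])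
    ultimately show "r \<in> ?E" by (auto intro!: exI[of _ "complex_of_real r"])
  qed
  then show ?thesis by (simp add: lambda_min_def)
qed

lemma lambda_min_le:
  assumes "hermitian M" shows "loewner_le (scal (lambda_min M)) M"
proof -
  obtain U d where "unitary U" "M = udiag U d"
    using hermitian_spectral[OF assms] unfolding udiag_def by blast
  then show ?thesis by (simp add: lambda_min_udiag loewner_le_scal_udiag)
qed

lemma lambda_min_pos:
  assumes "posdef M" shows "0 < lambda_min M"
proof -
  obtain U d where U: "unitary U" "\<And>i. 0 < d i" "M = udiag U d"
    using posdef_spectral[OF assms] by blast
  then show ?thesis by (simp add: lambda_min_udiag)
qed

section \<open>Spectral norm and Lipschitz bounds for powers\<close>

lemma norm_mult_vec_le: "norm (M *v x) \<le> specnorm M * norm x"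
  unfolding specnorm_def by (rule onorm) simp

lemma specnorm_leI: "(\<And>x. norm (M *v x) \<le> c * norm x) \<Longrightarrow> specnorm M \<le> c"
  unfolding specnorm_def by (rule onorm_le)

lemma specnorm_nonneg: "0 \<le> specnorm M"
  unfolding specnorm_def by (rule onorm_pos_le) simp

lemma specnorm_add: "specnorm (M + N) \<le> specnorm M + specnorm N"
  unfolding specnorm_def matrix_vector_mult_add_rdistrib by (rule onorm_triangle) simp_all

lemma specnorm_diff_commute: "specnorm (M - N) = specnorm (N - M)"
  unfolding specnorm_def matrix_vector_mult_diff_rdistrib
  using onorm_neg[of "\<lambda>x. M *v x - N *v x"] by simp

lemma specnorm_mult: "specnorm (M ** N) \<le> specnorm M * specnorm N"
  using onorm_compose[of "(*v) M" "(*v) N"]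
  by (simp add: specnorm_def comp_def matrix_vector_mul_assoc)

text \<open>Cauchy-Schwarz applied to the squared norm of \<open>adj M *v x\<close>, after which one
  factor cancels.\<close>

lemma specnorm_adj_le: "specnorm (adj M) \<le> specnorm M"
proof (rule specnorm_leI)
  fix x
  have "(norm (adj M *v x))\<^sup>2 = x \<bullet> (M *v (adj M *v x))"
    by (simp add: power2_norm_eq_inner inner_matrix_right)
  also have "\<dots> \<le> norm x * norm (M *v (adj M *v x))"
    by (rule norm_cauchy_schwarz)
  also have "\<dots> \<le> norm x * (specnorm M * norm (adj M *v x))"
    by (intro mult_left_mono norm_mult_vec_le) simp
  finally have "norm (adj M *v x) * norm (adj M *v x) \<le> (specnorm M * norm x) * norm (adj M *v x)"
    by (simp add: power2_eq_square mult_ac)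
  then show "norm (adj M *v x) \<le> specnorm M * norm x"
    using specnorm_nonneg[of M]
    by (cases "adj M *v x = 0") (simp_all add: mult_le_cancel_right)
qed

lemma specnorm_adj: "specnorm (adj M) = specnorm M"
  using specnorm_adj_le[of M] specnorm_adj_le[of "adj M"] by simp

text \<open>Translates between norm and order. Forwards this is Cauchy-Schwarz; backwards the order
  bounds give \<open>\<bar>d i\<bar> \<le> c\<close> for the eigenvalues, and \<open>D ** D\<close>
  is diagonalised by the same \<open>U\<close>.\<close>

lemma specnorm_le_iff_loewner:
  assumes "hermitian D"
  shows "specnorm D \<le> c \<longleftrightarrow> loewner_le (scal (- c)) D \<and> loewner_le D (scal c)"
proof
  assume le: "specnorm D \<le> c"
  have "\<bar>x \<bullet> (D *v x)\<bar> \<le> c * (x \<bullet> x)" for x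
  proof -
    have "\<bar>x \<bullet> (D *v x)\<bar> \<le> norm x * norm (D *v x)" by (rule Cauchy_Schwarz_ineq2)
    also have "\<dots> \<le> norm x * (c * norm x)"
      using norm_mult_vec_le[of D x] mult_right_mono[OF le norm_ge_zero[of x]]
      by (intro mult_left_mono) auto
    finally show ?thesis by (simp add: power2_norm_eq_inner[symmetric] power2_eq_square mult_ac)
  qed
  then show "loewner_le (scal (- c)) D \<and> loewner_le D (scal c)"
    using assms by (simp add: loewner_le_iff scal_mult_vec abs_le_iff minus_le_iff)
next
  assume le: "loewner_le (scal (- c)) D \<and> loewner_le D (scal c)"
  obtain U d where U: "unitary U" and D: "D = udiag U d"
    using hermitian_spectral[OF assms] unfolding udiag_def by blast
  have dc: "\<bar>d i\<bar> \<le> c" for i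
    using le unfolding D loewner_le_scal_udiag[OF U] loewner_le_udiag_scal[OF U]
    by (auto simp: abs_le_iff minus_le_iff)
  then have c: "0 \<le> c" by (meson abs_ge_zero order_trans)
  have d2: "d i * d i \<le> c\<^sup>2" for i
    using dc[of i] by (metis abs_le_square_iff abs_of_nonneg c power2_eq_square)
  show "specnorm D \<le> c"
  proof (rule specnorm_leI)
    fix x
    have "(norm (D *v x))\<^sup>2 = x \<bullet> (udiag U (\<lambda>i. d i * d i) *v x)"
      unfolding udiag_mult[OF U, symmetric] D[symmetric]
      by (simp add: power2_norm_eq_inner hermitian_inner[OF assms] flip: matrix_vector_mul_assoc)
    also have "\<dots> \<le> c\<^sup>2 * (norm x)\<^sup>2"
      unfolding inner_udiag norm_power2_unitary[OF U] sum_distrib_left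
      by (intro sum_mono mult_right_mono d2) simp
    finally show "norm (D *v x) \<le> c * norm x"
      using c by (simp add: power_mult_distrib[symmetric])
  qed
qed

text \<open>Limits and completeness refer to the Euclidean norm of matrices, the contraction to
  \<open>specnorm\<close>. Each entry is a component of the image of a basis vector; summing crudely
  over rows and columns gives the constant.\<close>

lemma norm_le_specnorm:
  fixes M :: "complex^'n^'n"
  shows "norm M \<le> (real CARD('n))\<^sup>2 * specnorm M"
proof -
  have entry: "norm (M $ i $ j) \<le> specnorm M" for i j
  proof -
    have "norm (M $ i $ j) = norm ((M *v axis j 1) $ i)"
      by (simp add: matrix_vector_mult_def axis_def if_distrib[of "\<lambda>u. _ * u"] cong: if_cong)
    also have "\<dots> \<le> norm (M *v axis j 1)" by (rule Finite_Cartesian_Product.norm_nth_le)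
    also have "\<dots> \<le> specnorm M * norm (axis j (1::complex))" by (rule norm_mult_vec_le)
    also have "norm (axis j (1::complex)) = 1" by (simp add: norm_eq_1 inner_axis_axis)
    finally show ?thesis by simp
  qed
  have row: "norm (M $ i) \<le> real CARD('n) * specnorm M" for i
  proof -
    have "norm (M $ i) \<le> (\<Sum>j\<in>UNIV. norm (M $ i $ j))"
      unfolding norm_vec_def by (rule L2_set_le_sum) simp
    also have "\<dots> \<le> real CARD('n) * specnorm M"
      by (rule sum_bounded_above) (rule entry)
    finally show ?thesis .
  qed
  have "norm M \<le> (\<Sum>i\<in>UNIV. norm (M $ i))"
    unfolding norm_vec_def by (rule L2_set_le_sum) simp
  also have "\<dots> \<le> real CARD('n) * (real CARD('n) * specnorm M)"
    by (rule sum_bounded_above) (rule row)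
  finally show ?thesis by (simp add: power2_eq_square mult_ac)
qed

text \<open>The converse comparison: matrix-vector multiplication is bilinear on finite-dimensional
  spaces, hence bounded.\<close>

lemma specnorm_le_norm:
  obtains K where "\<And>M :: complex^'n^'n. specnorm M \<le> K * norm M"
proof -
  have "bilinear ((*v) :: complex^'n^'n \<Rightarrow> _)"
    unfolding bilinear_def
    by (auto intro!: linearI simp: matrix_vector_mult_add_rdistrib matrix_vector_right_distrib
        matrix_vector_scaleR)
       (simp add: matrix_vector_mult_def vec_eq_iff scaleR_sum_right)
  then obtain K where K: "\<And>(M :: complex^'n^'n) x. norm (M *v x) \<le> K * norm M * norm x"
    using bilinear_bounded by blast
  then have "specnorm M \<le> K * norm M" for M :: "complex^'n^'n"
    by (intro specnorm_leI)
  then show thesis using that by blast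
qed

section \<open>Inversion and the Loewner order\<close>

lemma scal_minus: "scal (- c) = - scal c"
  by (simp add: scal_def mat_def vec_eq_iff)

lemma psd_add: "psd M \<Longrightarrow> psd N \<Longrightarrow> psd (M + N)"
  by (simp add: psd_iff hermitian_add matrix_vector_mult_add_rdistrib inner_add_right)

lemma loewner_le_trans: "loewner_le P R \<Longrightarrow> loewner_le R T \<Longrightarrow> loewner_le P T"
  unfolding loewner_le_def using psd_add[of "T - R" "R - P"] by simp

lemma matrix_inv_hermitian:
  assumes "posdef M" shows "hermitian (matrix_inv M)"
  by (simp add: matrix_inv_posdef assms hermitian_mpow)

text \<open>For \<open>y\<close> and \<open>z\<close> the images of \<open>x\<close> under the
  inverses of \<open>M\<close> and \<open>N\<close>, expand the nonnegative form of \<open>N\<close>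
  at \<open>z - y\<close> and bound the form of \<open>N\<close> at \<open>y\<close> by that of
  \<open>M\<close>, which is \<open>x \<bullet> y\<close>.\<close>

lemma matrix_inv_antimono:
  assumes N: "posdef N" and M: "posdef M" and le: "loewner_le N M"
  shows "loewner_le (matrix_inv M) (matrix_inv N)"
proof -
  have hN: "hermitian N" and hM: "hermitian M" using N M by (auto simp: posdef_def)
  have "x \<bullet> (matrix_inv M *v x) \<le> x \<bullet> (matrix_inv N *v x)" for x
  proof -
    let ?y = "matrix_inv M *v x" and ?z = "matrix_inv N *v x"
    have My: "M *v ?y = x" and Nz: "N *v ?z = x"
      using matrix_inv_cancel(1)[OF posdef_invertible[OF M]] matrix_inv_cancel(1)[OF posdef_invertible[OF N]]
      by (simp_all add: matrix_vector_mul_assoc)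
    have "0 \<le> (?z - ?y) \<bullet> (N *v (?z - ?y))"
      using N unfolding posdef_iff by (cases "?z - ?y = 0") (auto intro: less_imp_le)
    also have "\<dots> = x \<bullet> ?z - 2 * (x \<bullet> ?y) + ?y \<bullet> (N *v ?y)"
      using hermitian_inner[OF hN, of ?z ?y]
      by (simp add: matrix_vector_mult_diff_distrib inner_diff_left inner_diff_right Nz inner_commute)
    also have "?y \<bullet> (N *v ?y) \<le> ?y \<bullet> (M *v ?y)"
      using le hN hM by (simp add: loewner_le_iff)
    also have "\<dots> = x \<bullet> ?y" by (simp add: My inner_commute)
    finally show ?thesis by simp
  qed
  then show ?thesis by (simp add: loewner_le_iff matrix_inv_hermitian N M)
qed

section \<open>The Loewner-Heinz inequality\<close>

lemma norm_mpow_half: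
  assumes "posdef X" shows "(norm (mpow X (r / 2) *v x))\<^sup>2 = x \<bullet> (mpow X r *v x)"
  using mpow_add[OF assms, of "r / 2" "r / 2"]
  by (simp add: power2_norm_eq_inner hermitian_inner[OF hermitian_mpow[OF assms]] flip: matrix_vector_mul_assoc)

text \<open>Pedersen's argument: for \<open>c = (\<alpha> + \<beta>) / 2\<close> the matrix \<open>Y powr (-c/2) X powr c Y powr (-c/2)\<close> is similar to
  \<open>Y powr (-\<alpha>/2) X powr c Y powr (-\<beta>/2)\<close>, a product of two contractions, so its eigenvalues are at most 1.\<close>

lemma mpow_mono_midpoint:
  assumes X: "posdef X" and Y: "posdef Y"
    and \<alpha>: "loewner_le (mpow X \<alpha>) (mpow Y \<alpha>)" and \<beta>: "loewner_le (mpow X \<beta>) (mpow Y \<beta>)"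
  shows "loewner_le (mpow X ((\<alpha> + \<beta>) / 2)) (mpow Y ((\<alpha> + \<beta>) / 2))"
proof -
  define c where "c = (\<alpha> + \<beta>) / 2"
  \<comment> \<open>The order relation compares the norms of \<open>mpow X (r / 2) *v x\<close> and
    \<open>mpow Y (r / 2) *v x\<close>; substituting \<open>x = mpow Y (- r / 2) *v y\<close> turns
    it into a contraction.\<close>
  have contr: "specnorm (mpow X (r / 2) ** mpow Y (- r / 2)) \<le> 1"
    if r: "loewner_le (mpow X r) (mpow Y r)" for r
  proof (rule specnorm_leI)
    fix y
    let ?x = "mpow Y (- r / 2) *v y"
    have "(norm (mpow X (r / 2) *v ?x))\<^sup>2 \<le> (norm (mpow Y (r / 2) *v ?x))\<^sup>2"
      using r by (simp add: norm_mpow_half X Y loewner_le_iff hermitian_mpow)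
    moreover have "mpow Y (r / 2) *v ?x = y"
      using mpow_cancel(1)[OF Y, of "r / 2"] by (simp add: matrix_vector_mul_assoc)
    ultimately show "norm ((mpow X (r / 2) ** mpow Y (- r / 2)) *v y) \<le> 1 * norm y"
      by (simp add: matrix_vector_mul_assoc)
  qed
  define N where "N = mpow Y (- c / 2) ** mpow X c ** mpow Y (- c / 2)"
  define T where "T = adj (mpow X (\<alpha> / 2) ** mpow Y (- \<alpha> / 2)) ** (mpow X (\<beta> / 2) ** mpow Y (- \<beta> / 2))"
  have T1: "specnorm T \<le> 1"
  proof -
    have "specnorm T \<le> specnorm (mpow X (\<alpha> / 2) ** mpow Y (- \<alpha> / 2)) * specnorm (mpow X (\<beta> / 2) ** mpow Y (- \<beta> / 2))"
      unfolding T_def by (rule order_trans[OF specnorm_mult]) (simp add: specnorm_adj)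
    also have "\<dots> \<le> 1 * 1"
      by (intro mult_mono contr \<alpha> \<beta>) (simp_all add: specnorm_nonneg)
    finally show ?thesis by simp
  qed
  have T: "T = mpow Y (- \<alpha> / 2) ** mpow X c ** mpow Y (- \<beta> / 2)"
  proof -
    have "c = \<alpha> / 2 + \<beta> / 2" by (simp add: c_def)
    then show ?thesis unfolding T_def
      by (simp only: adj_mult adj_mpow[OF X] adj_mpow[OF Y] mpow_add[OF X] matrix_mul_assoc)
  qed
  \<comment> \<open>The exponent \<open>(c - \<alpha>) / 2\<close> is the one that moves the unequal
    outer exponents of \<open>T\<close> to the common value \<open>- c / 2\<close>.\<close>
  have sim: "T ** mpow Y ((c - \<alpha>) / 2) = mpow Y ((c - \<alpha>) / 2) ** N"
  proof -
    have 1: "mpow Y (- \<beta> / 2) ** mpow Y ((c - \<alpha>) / 2) = mpow Y (- c / 2)"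
      unfolding mpow_add[OF Y, symmetric] by (rule arg_cong[of _ _ "mpow Y"]) (simp add: c_def field_simps)
    have 2: "mpow Y ((c - \<alpha>) / 2) ** mpow Y (- c / 2) = mpow Y (- \<alpha> / 2)"
      unfolding mpow_add[OF Y, symmetric] by (rule arg_cong[of _ _ "mpow Y"]) (simp add: c_def field_simps)
    have "T ** mpow Y ((c - \<alpha>) / 2) = mpow Y (- \<alpha> / 2) ** mpow X c ** (mpow Y (- \<beta> / 2) ** mpow Y ((c - \<alpha>) / 2))"
      unfolding T by (simp only: matrix_mul_assoc)
    also have "\<dots> = mpow Y ((c - \<alpha>) / 2) ** N"
      unfolding 1 N_def 2[symmetric] by (simp only: matrix_mul_assoc)
    finally show ?thesis .
  qed
  have hN: "hermitian N"
    using hermitian_sandwich[OF hermitian_mpow[OF X], of "mpow Y (- c / 2)"]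
    by (simp add: N_def adj_mpow Y)
  obtain U d where U: "unitary U" and Nd: "N = udiag U d"
    using hermitian_spectral[OF hN] unfolding udiag_def by blast
  \<comment> \<open>Similarity transfers eigenvalues from \<open>N\<close> to \<open>T\<close>,
    where the norm bounds them; since \<open>N\<close> is Hermitian, its eigenvalues in turn decide
    its order.\<close>
  have "d i \<le> 1" for i
  proof -
    define v where "v = U *v axis i 1"
    define w where "w = mpow Y ((c - \<alpha>) / 2) *v v"
    have v: "N *v v = d i *\<^sub>R v" "norm v = 1"
      unfolding v_def Nd by (rule udiag_eigenvector[OF U])+
    have "mpow Y (- ((c - \<alpha>) / 2)) *v w = v"
      unfolding w_def using mpow_cancel(2)[OF Y, of "(c - \<alpha>) / 2"] by (simp add: matrix_vector_mul_assoc)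
    then have "w \<noteq> 0" using v(2) by auto
    have "T *v w = (T ** mpow Y ((c - \<alpha>) / 2)) *v v"
      by (simp only: w_def matrix_vector_mul_assoc)
    also have "\<dots> = mpow Y ((c - \<alpha>) / 2) *v (N *v v)"
      by (simp only: sim matrix_vector_mul_assoc)
    also have "\<dots> = d i *\<^sub>R w" by (simp add: v w_def matrix_vector_scaleR)
    finally have "\<bar>d i\<bar> * norm w \<le> specnorm T * norm w"
      using norm_mult_vec_le[of T w] by simp
    then show "d i \<le> 1" using \<open>w \<noteq> 0\<close> T1 by (simp add: mult_le_cancel_right)
  qed
  then have N1: "loewner_le N (scal 1)"
    by (simp add: Nd loewner_le_udiag_scal U)
  \<comment> \<open>Undo the congruence: evaluate \<open>N\<close> at
    \<open>mpow Y (c / 2) *v x\<close>.\<close>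
  have "x \<bullet> (mpow X c *v x) \<le> x \<bullet> (mpow Y c *v x)" for x
  proof -
    let ?y = "mpow Y (c / 2) *v x"
    have canc: "mpow Y (- (c / 2)) *v ?y = x"
      using mpow_cancel(2)[OF Y, of "c / 2"] by (simp add: matrix_vector_mul_assoc)
    have "x \<bullet> (mpow X c *v x) = ?y \<bullet> (N *v ?y)"
      using hermitian_inner[OF hermitian_mpow[OF Y], of ?y "- c / 2" "mpow X c *v x"]
      by (simp add: N_def canc flip: matrix_vector_mul_assoc)
    also have "\<dots> \<le> ?y \<bullet> (scal 1 *v ?y)"
      using N1 hN by (simp add: loewner_le_iff)
    also have "\<dots> = x \<bullet> (mpow Y c *v x)"
      using norm_mpow_half[OF Y, of c x] by (simp add: scal_mult_vec power2_norm_eq_inner)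
    finally show ?thesis .
  qed
  then show ?thesis by (simp add: loewner_le_iff hermitian_mpow X Y flip: c_def)
qed

lemma continuous_inner_mpow:
  assumes "posdef X" shows "continuous_on UNIV (\<lambda>r. x \<bullet> (mpow X r *v x))"
proof -
  obtain U d where "unitary U" and d: "\<And>i. 0 < d i" and "X = udiag U d"
    using posdef_spectral[OF assms] by blast
  then have "x \<bullet> (mpow X r *v x) = (\<Sum>i\<in>UNIV. d i powr r * (norm ((adj U *v x) $ i))\<^sup>2)" for r
    by (simp add: mpow_udiag inner_udiag)
  moreover have "d i \<noteq> 0" for i using d[of i] by simp
  ultimately show ?thesis by (auto intro!: continuous_intros)
qed

text \<open>A missing point \<open>c\<close> would have nearest members of \<open>S\<close> on its
  left and on its right; their midpoint belongs to \<open>S\<close> and is nearer to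
  \<open>c\<close> on one side.\<close>

lemma closed_midpoint_interval:
  fixes S :: "real set"
  assumes S: "closed S" and mid: "\<And>x y. x \<in> S \<Longrightarrow> y \<in> S \<Longrightarrow> (x + y) / 2 \<in> S"
    and ab: "a \<in> S" "b \<in> S"
  shows "{a..b} \<subseteq> S"
proof
  fix c assume c: "c \<in> {a..b}"
  show "c \<in> S"
  proof (rule ccontr)
    assume "c \<notin> S"
    define l where "l = Sup (S \<inter> {a..c})"
    define r where "r = Inf (S \<inter> {c..b})"
    have "l \<in> S \<inter> {a..c}" unfolding l_def
      using S ab c by (intro closed_contains_Sup) auto
    moreover have "r \<in> S \<inter> {c..b}" unfolding r_def
      using S ab c by (intro closed_contains_Inf) auto
    ultimately have l: "l \<in> S" "a \<le> l" "l < c" and r: "r \<in> S" "c < r" "r \<le> b"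
      using \<open>c \<notin> S\<close> by (auto simp: less_le)
    have m: "(l + r) / 2 \<in> S" using mid l r by blast
    show False
    proof (cases "(l + r) / 2 \<le> c")
      case True
      then have "(l + r) / 2 \<le> l"
        unfolding l_def[symmetric] using m l r
        by (subst (2) l_def) (intro cSup_upper; auto)
      then show False using l r by simp
    next
      case False
      then have "r \<le> (l + r) / 2"
        using m l r by (subst r_def) (intro cInf_lower; auto)
      then show False using l r by simp
    qed
  qed
qed

text \<open>The exponents that preserve the relation form a closed set, stable under midpoints,
  containing 0 and 1.\<close>

theorem loewner_heinz:
  assumes X: "posdef X" and Y: "posdef Y" and le: "loewner_le X Y" and r: "0 \<le> r" "r \<le> 1"
  shows "loewner_le (mpow X r) (mpow Y r)"
proof -
  define S where "S = {q. loewner_le (mpow X q) (mpow Y q)}"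
  have "S = (\<Inter>x. {q. x \<bullet> (mpow X q *v x) \<le> x \<bullet> (mpow Y q *v x)})"
    by (auto simp: S_def loewner_le_iff hermitian_mpow X Y)
  then have "closed S"
    by (auto intro!: closed_INT closed_Collect_le continuous_inner_mpow X Y)
  moreover have "0 \<in> S" "1 \<in> S"
    using le by (auto simp: S_def mpow_0 mpow_1 X Y loewner_le_def psd_iff hermitian_def adj_diff)
  moreover have "(p + q) / 2 \<in> S" if "p \<in> S" "q \<in> S" for p q
    using mpow_mono_midpoint[OF X Y] that by (simp add: S_def)
  ultimately have "{0..1} \<subseteq> S" by (intro closed_midpoint_interval)
  then show ?thesis using r by (auto simp: S_def)
qed

lemma mpow_antimono:
  assumes X: "posdef X" and Y: "posdef Y" and le: "loewner_le X Y" and r: "- 1 \<le> r" "r \<le> 0"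
  shows "loewner_le (mpow Y r) (mpow X r)"
  using matrix_inv_antimono[OF posdef_mpow[OF X] posdef_mpow[OF Y] loewner_heinz[OF X Y le, of "- r"]] r
  by (simp add: matrix_inv_mpow X Y)

text \<open>Mean value theorem; as \<open>r \<le> 1\<close>, the factor
  \<open>z powr (r - 1)\<close> is largest at the left end, where it is bounded by its value at
  \<open>a\<close>.\<close>

lemma powr_increment_le:
  fixes a x c r :: real
  assumes "0 < a" "a \<le> x" "0 \<le> c" "r \<le> 1"
  shows "\<bar>(x + c) powr r - x powr r\<bar> \<le> \<bar>r\<bar> * a powr (r - 1) * c"
proof (cases "c = 0")
  case False
  with assms have "x < x + c" by simp
  then obtain z where z: "x < z" "z < x + c"
    "(x + c) powr r - x powr r = (x + c - x) * (r * z powr (r - 1))"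
    using MVT2[of x "x + c" "\<lambda>u. u powr r" "\<lambda>u. r * u powr (r - 1)"] assms
    by (force intro!: derivative_eq_intros)
  have "z powr (r - 1) \<le> a powr (r - 1)"
    using assms z by (intro powr_mono2') auto
  then have "c * (\<bar>r\<bar> * z powr (r - 1)) \<le> c * (\<bar>r\<bar> * a powr (r - 1))"
    using assms by (intro mult_left_mono) auto
  then show ?thesis using z(3) assms by (simp add: abs_mult mult_ac)
qed simp

theorem specnorm_mpow_diff_le:
  assumes X: "posdef X" and Y: "posdef Y" and a: "0 < a" "loewner_le (scal a) X" "loewner_le (scal a) Y"
    and r: "- 1 \<le> r" "r \<le> 1"
  shows "specnorm (mpow X r - mpow Y r) \<le> \<bar>r\<bar> * a powr (r - 1) * specnorm (X - Y)"
proof -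
  let ?c = "specnorm (X - Y)" and ?L = "\<bar>r\<bar> * a powr (r - 1) * specnorm (X - Y)"
  \<comment> \<open>\<open>P\<close> and \<open>P + scal ?c\<close> share an eigenbasis, so the
    scalar increment bound applies to each eigenvalue.\<close>
  have shift: "posdef (P + scal ?c) \<and> loewner_le (mpow (P + scal ?c) r) (mpow P r + scal ?L)
      \<and> loewner_le (mpow P r) (mpow (P + scal ?c) r + scal ?L)"
    if P: "posdef P" "loewner_le (scal a) P" for P
  proof -
    obtain U d where U: "unitary U" and d: "\<And>i. 0 < d i" and Pd: "P = udiag U d"
      using posdef_spectral[OF P(1)] by blast
    have ad: "a \<le> d i" for i
      using P(2) unfolding Pd loewner_le_scal_udiag[OF U] by blast
    have dc: "0 < d i + ?c" for i
      using d[of i] specnorm_nonneg[of "X - Y"] by linarith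
    have Pc: "P + scal ?c = udiag U (\<lambda>i. d i + ?c)"
      by (simp add: Pd udiag_const[OF U, symmetric] udiag_add)
    have inc: "\<bar>(d i + ?c) powr r - d i powr r\<bar> \<le> ?L" for i
      using a(1) ad specnorm_nonneg r by (intro powr_increment_le)
    have inc': "(d i + ?c) powr r \<le> d i powr r + ?L" "d i powr r \<le> (d i + ?c) powr r + ?L" for i
      using inc[of i] by linarith+
    show ?thesis
      using dc inc' unfolding Pc unfolding Pd mpow_udiag[OF U d] mpow_udiag[OF U dc] udiag_const[OF U, of ?L, symmetric]
      by (simp add: udiag_add udiag_diff loewner_le_def psd_udiag_iff posdef_udiag_iff U)
  qed
  \<comment> \<open>Here \<open>P\<close> and \<open>R\<close> need not commute: operator
    monotonicity compares one with the shift of the other, and \<open>shift\<close> removes the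
    added scalar.\<close>
  have le: "loewner_le (mpow P r) (mpow R r + scal ?L)"
    if P: "posdef P" "loewner_le (scal a) P" and R: "posdef R" "loewner_le (scal a) R"
      and c: "loewner_le P (R + scal ?c)" "loewner_le R (P + scal ?c)" for P R
  proof (cases "0 \<le> r")
    case True
    then have "loewner_le (mpow P r) (mpow (R + scal ?c) r)"
      using P R c r shift[OF R] by (intro loewner_heinz) auto
    then show ?thesis using shift[OF R] loewner_le_trans by blast
  next
    case False
    then have "loewner_le (mpow (P + scal ?c) r) (mpow R r)"
      using P R c r shift[OF P] by (intro mpow_antimono) auto
    then have "loewner_le (mpow (P + scal ?c) r + scal ?L) (mpow R r + scal ?L)"
      by (simp add: loewner_le_def)
    then show ?thesis using shift[OF P] loewner_le_trans by blast
  qed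
  have hX: "hermitian X" and hY: "hermitian Y" using X Y by (auto simp: posdef_def)
  have "loewner_le (scal (- ?c)) (X - Y) \<and> loewner_le (X - Y) (scal ?c)"
    using specnorm_le_iff_loewner[OF hermitian_diff[OF hX hY], of ?c] by simp
  then have "loewner_le X (Y + scal ?c)" "loewner_le Y (X + scal ?c)"
    by (simp_all add: loewner_le_def scal_minus algebra_simps)
  then have "loewner_le (mpow X r) (mpow Y r + scal ?L)" "loewner_le (mpow Y r) (mpow X r + scal ?L)"
    using X Y a by (auto intro: le)
  then show ?thesis
    by (simp add: specnorm_le_iff_loewner hermitian_diff hermitian_mpow X Y)
       (simp add: loewner_le_def scal_minus algebra_simps)
qed

section \<open>Coupled contractions\<close>

text \<open>\<open>N\<close> plays the spectral norm; \<open>C\<close> and \<open>K\<close> compare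
  it with the norm in which the space is complete. The last assumption makes the map sending
  \<open>(x, y)\<close> to \<open>(F x y, F y x)\<close> a contraction for the maximum of
  \<open>N\<close> over the two components.\<close>

locale coupled_contraction =
  fixes F :: "'a::banach \<Rightarrow> 'a \<Rightarrow> 'a" and N :: "'a \<Rightarrow> real" and S :: "'a set"
    and C K \<delta> :: real and x0 y0 :: 'a
  assumes N_nonneg: "0 \<le> N x" and N_add: "N (x + y) \<le> N x + N y"
    and N_commute: "N (x - y) = N (y - x)"
    and C: "0 \<le> C" "norm x \<le> C * N x" and K: "N x \<le> K * norm x"
    and S: "closed S" "x0 \<in> S" "y0 \<in> S"
    and maps: "x \<in> S \<Longrightarrow> y \<in> S \<Longrightarrow> F x y \<in> S"
    and \<delta>: "0 \<le> \<delta>" "\<delta> < 1"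
    and contr: "x \<in> S \<Longrightarrow> y \<in> S \<Longrightarrow> x' \<in> S \<Longrightarrow> y' \<in> S \<Longrightarrow>
      N (F x y - F x' y') \<le> \<delta> * max (N (x - x')) (N (y - y'))"
begin

definition "X k = fst (pair_iter F x0 y0 k)"
definition "Y k = snd (pair_iter F x0 y0 k)"

lemma XY_Suc: "X (Suc k) = F (X k) (Y k)" "Y (Suc k) = F (Y k) (X k)"
  by (simp_all add: X_def Y_def)

lemma XY_in: "X k \<in> S" "Y k \<in> S"
proof (induction k)
  case 0
  { case 1 show ?case using S by (simp add: X_def) }
  { case 2 show ?case using S by (simp add: Y_def) }
next
  case (Suc k)
  { case 1 show ?case using Suc maps by (simp add: XY_Suc) }
  { case 2 show ?case using Suc maps by (simp add: XY_Suc) }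
qed

lemma N_eq_0: "N x \<le> 0 \<Longrightarrow> x = 0"
  using C(2)[of x] N_nonneg[of x] by simp

lemma step_le:
  "max (N (X (Suc k) - X k)) (N (Y (Suc k) - Y k)) \<le> \<delta> ^ k * max (N (X 1 - X 0)) (N (Y 1 - Y 0))"
proof (induction k)
  case (Suc k)
  let ?m = "max (N (X (Suc k) - X k)) (N (Y (Suc k) - Y k))"
  have "N (X (Suc (Suc k)) - X (Suc k)) \<le> \<delta> * ?m" "N (Y (Suc (Suc k)) - Y (Suc k)) \<le> \<delta> * ?m"
    using contr[OF XY_in XY_in, of "Suc k" "Suc k" k k]
      contr[OF XY_in(2,1) XY_in(2,1), of "Suc k" "Suc k" k k]
    by (simp_all add: XY_Suc[of "Suc k"] XY_Suc[of k] max.commute)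
  moreover have "\<delta> * ?m \<le> \<delta> * (\<delta> ^ k * max (N (X 1 - X 0)) (N (Y 1 - Y 0)))"
    using Suc \<delta> by (intro mult_left_mono)
  ultimately show ?case by (simp add: mult.assoc)
qed simp

text \<open>The telescoping series of increments is dominated by a geometric series, so completeness
  applies.\<close>

lemma convergent_of_geometric:
  assumes "\<And>k. N (Z (Suc k) - Z k) \<le> \<delta> ^ k * m"
  shows "convergent Z"
proof -
  have "summable (\<lambda>k. Z (Suc k) - Z k)"
  proof (rule summable_comparison_test')
    show "summable (\<lambda>k. C * (\<delta> ^ k * m))"
      using \<delta> by (intro summable_mult summable_mult2 summable_geometric) simp
    fix k :: nat assume "k \<ge> 0"
    show "norm (Z (Suc k) - Z k) \<le> C * (\<delta> ^ k * m)"
      using C(2)[of "Z (Suc k) - Z k"] mult_left_mono[OF assms C(1), of k] by linarith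
  qed
  from summable_LIMSEQ[OF this] obtain l where "(\<lambda>n. \<Sum>k<n. Z (Suc k) - Z k) \<longlonglongrightarrow> l" by blast
  then have "(\<lambda>n. Z n - Z 0) \<longlonglongrightarrow> l" by (simp add: sum_lessThan_telescope)
  from tendsto_add[OF this tendsto_const[of "Z 0"]] have "Z \<longlonglongrightarrow> l + Z 0" by simp
  then show ?thesis by (rule convergentI)
qed

text \<open>Sequential continuity of \<open>F\<close> on \<open>S\<close>: \<open>K\<close> passes
  from the norm to \<open>N\<close>, the contraction acts, and \<open>C\<close> passes back.\<close>

lemma tendsto_F:
  assumes "U \<longlonglongrightarrow> u" "V \<longlonglongrightarrow> v" "\<And>k. U k \<in> S" "\<And>k. V k \<in> S" "u \<in> S" "v \<in> S"
  shows "(\<lambda>k. F (U k) (V k)) \<longlonglongrightarrow> F u v"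
proof -
  have "(\<lambda>k. C * (\<delta> * max (K * norm (U k - u)) (K * norm (V k - v)))) \<longlonglongrightarrow>
      C * (\<delta> * max (K * norm (u - u)) (K * norm (v - v)))"
    by (intro tendsto_intros assms)
  then have lim: "(\<lambda>k. C * (\<delta> * max (K * norm (U k - u)) (K * norm (V k - v)))) \<longlonglongrightarrow> 0"
    by simp
  have "norm (F (U k) (V k) - F u v) \<le> C * (\<delta> * max (K * norm (U k - u)) (K * norm (V k - v)))" for k
  proof -
    have "norm (F (U k) (V k) - F u v) \<le> C * N (F (U k) (V k) - F u v)" by (rule C(2))
    also have "\<dots> \<le> C * (\<delta> * max (N (U k - u)) (N (V k - v)))"
      using assms by (intro mult_left_mono contr C(1))
    also have "\<dots> \<le> C * (\<delta> * max (K * norm (U k - u)) (K * norm (V k - v)))"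
      using \<delta> C(1) by (intro mult_left_mono max.mono K)
    finally show ?thesis .
  qed
  then have "(\<lambda>k. F (U k) (V k) - F u v) \<longlonglongrightarrow> 0"
    by (intro Lim_null_comparison[OF always_eventually lim] allI)
  then show ?thesis by (rule LIM_zero_cancel)
qed

lemma contr_eq:
  assumes "N (u - v) \<le> \<delta> * N (u - v)" shows "u = v"
proof -
  have "(1 - \<delta>) * N (u - v) \<le> 0" using assms by (simp add: algebra_simps)
  then have "N (u - v) \<le> 0" using \<delta> by (simp add: mult_le_0_iff)
  then show ?thesis using N_eq_0[of "u - v"] by simp
qed

lemma fixed_point:
  obtains z where "z \<in> S" "F z z = z" "X \<longlonglongrightarrow> z" "Y \<longlonglongrightarrow> z"
proof -
  obtain u v where u: "X \<longlonglongrightarrow> u" and v: "Y \<longlonglongrightarrow> v"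
    using convergent_of_geometric[of X] convergent_of_geometric[of Y] step_le
    unfolding max.bounded_iff convergent_def by blast
  have uS: "u \<in> S" and vS: "v \<in> S"
    using closed_sequentially[OF S(1)] XY_in u v by blast+
  have "(\<lambda>k. X (Suc k)) \<longlonglongrightarrow> F u v" "(\<lambda>k. Y (Suc k)) \<longlonglongrightarrow> F v u"
    unfolding XY_Suc by (intro tendsto_F u v uS vS XY_in)+
  then have Fu: "F u v = u" and Fv: "F v u = v"
    using u v LIMSEQ_unique LIMSEQ_Suc by blast+
  \<comment> \<open>The limits satisfy the swapped pair of equations; contracting from
    \<open>(u, v)\<close> to \<open>(v, u)\<close> makes them coincide.\<close>
  have "N (u - v) \<le> \<delta> * N (u - v)"
    using contr[OF uS vS vS uS] by (simp add: Fu Fv N_commute[of v u])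
  then have "u = v" by (rule contr_eq)
  then show thesis using that uS Fu u v by blast
qed

lemma fixed_point_unique:
  assumes "z \<in> S" "F z z = z" "w \<in> S" "F w w = w" shows "w = z"
  using contr[of w w z z] assms by (intro contr_eq) simp

text \<open>The error shrinks by \<open>\<delta>\<close> at each step. The triangle inequality gives
  \<open>e 0 \<le> m + \<delta> * e 0\<close>, which bounds the initial error by the first increment
  \<open>m\<close>.\<close>

lemma error_bound:
  assumes z: "z \<in> S" "F z z = z"
  shows "max (N (X k - z)) (N (Y k - z)) \<le> \<delta> ^ k / (1 - \<delta>) * max (N (X 1 - X 0)) (N (Y 1 - Y 0))"
proof -
  define e where "e k = max (N (X k - z)) (N (Y k - z))" for k
  define m where "m = max (N (X 1 - X 0)) (N (Y 1 - Y 0))"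
  have e_Suc: "e (Suc k) \<le> \<delta> * e k" for k
    using contr[OF XY_in z(1) z(1), of k k] contr[OF XY_in(2,1) z(1) z(1), of k k]
    by (simp add: e_def XY_Suc z max.commute)
  have e_pow: "e k \<le> \<delta> ^ k * e 0"
  proof (induction k)
    case (Suc k)
    from e_Suc[of k] mult_left_mono[OF Suc \<delta>(1)] show ?case by (simp add: mult.assoc)
  qed simp
  have "e 0 \<le> m + e 1"
  proof -
    have "N (X 0 - z) \<le> N (X 1 - X 0) + N (X 1 - z)" "N (Y 0 - z) \<le> N (Y 1 - Y 0) + N (Y 1 - z)"
      using N_add[of "X 0 - X 1" "X 1 - z"] N_add[of "Y 0 - Y 1" "Y 1 - z"]
      by (simp_all add: N_commute)
    then show ?thesis unfolding e_def m_def by linarith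
  qed
  also have "e 1 \<le> \<delta> * e 0" using e_Suc[of 0] by simp
  finally have "e 0 \<le> m / (1 - \<delta>)" using \<delta> by (simp add: field_simps)
  then have "\<delta> ^ k * e 0 \<le> \<delta> ^ k * (m / (1 - \<delta>))"
    using \<delta> by (intro mult_left_mono) auto
  with e_pow show ?thesis by (simp add: e_def m_def)
qed

end

section \<open>Congruence transformations\<close>

lemma adj_matrix_inv_cancel:
  assumes "invertible A"
  shows "adj A ** adj (matrix_inv A) = mat 1" "adj (matrix_inv A) ** adj A = mat 1"
  by (simp_all add: adj_mult[symmetric] matrix_inv_cancel assms)

lemma invertible_adj: "invertible A \<Longrightarrow> invertible (adj A)"
  unfolding invertible_def[of "adj A"] using adj_matrix_inv_cancel by blast

lemma inner_sandwich: "x \<bullet> ((C ** M ** adj C) *v x) = (adj C *v x) \<bullet> (M *v (adj C *v x))"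
  by (simp add: inner_matrix_right[of x C] flip: matrix_vector_mul_assoc)

lemma psd_sandwich: "psd M \<Longrightarrow> psd (C ** M ** adj C)"
  by (simp add: psd_iff hermitian_sandwich inner_sandwich)

lemma loewner_le_sandwich:
  "loewner_le P R \<Longrightarrow> loewner_le (C ** P ** adj C) (C ** R ** adj C)"
  unfolding loewner_le_def using psd_sandwich[of "R - P" C]
  by (simp add: matrix_diff_ldistrib matrix_diff_rdistrib)

lemma posdef_sandwich:
  assumes "posdef M" "invertible C" shows "posdef (C ** M ** adj C)"
proof -
  have "adj C *v x \<noteq> 0" if "x \<noteq> 0" for x
  proof
    assume "adj C *v x = 0"
    then have "(adj (matrix_inv C) ** adj C) *v x = 0"
      by (simp flip: matrix_vector_mul_assoc)
    with that show False by (simp add: adj_matrix_inv_cancel assms)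
  qed
  with assms show ?thesis by (simp add: posdef_iff hermitian_sandwich inner_sandwich)
qed

lemma posdef_imp_psd: "posdef M \<Longrightarrow> psd M"
  unfolding posdef_iff psd_iff by (metis inner_zero_left less_imp_le order_refl)

text \<open>This makes the equation \<open>adj A ** matrix_inv X ** A = M\<close> equivalent to
  \<open>A ** matrix_inv M ** adj A = X\<close>: apply it to \<open>A\<close> and to \<open>adj A\<close>.\<close>

lemma matrix_inv_sandwich_cancel:
  fixes A X :: "complex^'n^'n"
  assumes A: "invertible A" and X: "invertible X"
  shows "A ** matrix_inv (adj A ** matrix_inv X ** A) ** adj A = X"
proof -
  let ?A' = "matrix_inv A"
  have AA: "A ** (?A' ** Z) = Z" "adj A ** (adj ?A' ** Z) = Z" for Z :: "complex^'n^'n"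
    by (simp_all add: matrix_mul_assoc matrix_inv_cancel adj_matrix_inv_cancel A)
  have XX: "matrix_inv X ** (X ** Z) = Z" for Z :: "complex^'n^'n"
    by (simp add: matrix_mul_assoc matrix_inv_cancel X)
  have "matrix_inv (adj A ** matrix_inv X ** A) = ?A' ** X ** adj ?A'"
    by (rule matrix_inv_eqI)
       (simp add: AA XX adj_matrix_inv_cancel A flip: matrix_mul_assoc)
  then show ?thesis
    by (simp add: AA adj_matrix_inv_cancel A flip: matrix_mul_assoc)
qed

lemma matrix_inv_scal: "c \<noteq> 0 \<Longrightarrow> matrix_inv (scal c) = scal (1 / c)"
  by (rule matrix_inv_eqI)
     (simp add: matrix_eq scal_mult_vec flip: matrix_vector_mul_assoc)

text \<open>Testing the lower bound at \<open>y = matrix_inv M *v x\<close> gives \<open>c\<close>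
  times the squared norm of \<open>y\<close> at most \<open>y \<bullet> x\<close>; Cauchy-Schwarz
  finishes.\<close>

lemma specnorm_matrix_inv_le:
  assumes M: "posdef M" and c: "0 < c" "loewner_le (scal c) M"
  shows "specnorm (matrix_inv M) \<le> 1 / c"
proof (rule specnorm_leI)
  fix x
  let ?y = "matrix_inv M *v x"
  have My: "M *v ?y = x"
    using matrix_inv_cancel(1)[OF posdef_invertible[OF M]] by (simp add: matrix_vector_mul_assoc)
  have "c * (norm ?y)\<^sup>2 = ?y \<bullet> (scal c *v ?y)"
    by (simp add: scal_mult_vec power2_norm_eq_inner)
  also have "\<dots> \<le> ?y \<bullet> (M *v ?y)"
    using c M by (simp add: loewner_le_iff posdef_def)
  also have "\<dots> \<le> norm ?y * norm x"
    unfolding My by (rule norm_cauchy_schwarz)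
  finally have "norm ?y * (c * norm ?y) \<le> norm ?y * norm x"
    by (simp add: power2_eq_square mult_ac)
  then have "c * norm ?y \<le> norm x"
    by (cases "?y = 0") simp_all
  then show "norm ?y \<le> 1 / c * norm x" using c by (simp add: field_simps)
qed

lemma specnorm_sandwich: "specnorm (C ** M ** adj C) \<le> (specnorm C)\<^sup>2 * specnorm M"
proof -
  have "specnorm (C ** M ** adj C) \<le> specnorm (C ** M) * specnorm (adj C)" by (rule specnorm_mult)
  also have "\<dots> \<le> specnorm C * specnorm M * specnorm C"
    unfolding specnorm_adj by (intro mult_right_mono specnorm_mult specnorm_nonneg)
  finally show ?thesis by (simp add: power2_eq_square mult_ac)
qed

lemma specnorm_matrix_inv_diff_le:
  assumes M: "posdef M" "loewner_le (scal c) M" and N: "posdef N" "loewner_le (scal c) N" and c: "0 < c"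
  shows "specnorm (matrix_inv M - matrix_inv N) \<le> specnorm (M - N) / c\<^sup>2"
proof -
  \<comment> \<open>The resolvent identity; each outer factor then contributes
    \<open>1 / c\<close>.\<close>
  have "matrix_inv M - matrix_inv N = matrix_inv M ** (N - M) ** matrix_inv N"
    using matrix_inv_cancel[OF posdef_invertible[OF M(1)]] matrix_inv_cancel[OF posdef_invertible[OF N(1)]]
    by (simp add: matrix_diff_ldistrib matrix_diff_rdistrib) (simp flip: matrix_mul_assoc)
  also have "specnorm \<dots> \<le> specnorm (matrix_inv M ** (N - M)) * specnorm (matrix_inv N)"
    by (rule specnorm_mult)
  also have "\<dots> \<le> (1 / c * specnorm (N - M)) * (1 / c)"
  proof (intro mult_mono)
    show "specnorm (matrix_inv M ** (N - M)) \<le> 1 / c * specnorm (N - M)"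
      by (rule order_trans[OF specnorm_mult])
         (intro mult_right_mono specnorm_matrix_inv_le M c specnorm_nonneg)
    show "specnorm (matrix_inv N) \<le> 1 / c" by (intro specnorm_matrix_inv_le N c)
  qed (use c in \<open>simp_all add: specnorm_nonneg\<close>)
  finally show ?thesis by (simp add: specnorm_diff_commute power2_eq_square)
qed

text \<open>For each fixed \<open>x\<close> the order conditions are closed inequalities between
  continuous functions of the matrix.\<close>

lemma closed_loewner_interval:
  fixes P R :: "complex^'n^'n"
  assumes "hermitian P" "hermitian R"
  shows "closed (loewner_interval P R)"
proof -
  have "linear (\<lambda>X. X *v x)" for x :: "complex^'n"
    by (intro linearI) (simp_all add: matrix_vector_mult_add_rdistrib,
        simp add: matrix_vector_mult_def vec_eq_iff scaleR_sum_right)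
  then have cont: "continuous_on UNIV (\<lambda>X. x \<bullet> (X *v x))" for x :: "complex^'n"
    by (intro continuous_intros linear_continuous_on) (simp add: linear_conv_bounded_linear)
  have "linear (adj :: complex^'n^'n \<Rightarrow> _)"
    by (intro linearI) (simp_all add: adj_def vec_eq_iff)
  then have cont': "continuous_on UNIV (adj :: complex^'n^'n \<Rightarrow> _)"
    by (intro linear_continuous_on) (simp add: linear_conv_bounded_linear)
  have "loewner_interval P R = {X. adj X = X} \<inter>
      (\<Inter>x. {X. x \<bullet> (P *v x) \<le> x \<bullet> (X *v x)} \<inter> {X. x \<bullet> (X *v x) \<le> x \<bullet> (R *v x)})"
    using assms loewner_le_iff[of P] loewner_le_iff[of _ R]
    unfolding loewner_interval_def by (auto simp: hermitian_def)
  also have "closed \<dots>"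
    by (intro closed_Int closed_INT closed_Collect_eq closed_Collect_le cont cont' ballI continuous_intros)
  finally show ?thesis .
qed

section \<open>The matrix equation\<close>

theorem mainTheorem14:
  fixes s t p b :: real
    and A B Q :: "complex^'n^'n"
  assumes "1 \<le> s" "1 \<le> t" "1 \<le> p" "s \<le> t" "p \<le> t"
    and "invertible A" "invertible B" "posdef Q"
    and "0 < b"
  defines "a \<equiv> lambda_min (A ** matrix_inv Q ** adj A)"
  defines "\<theta> \<equiv> lambda_min (adj A ** A) / b"
  defines "F \<equiv> (\<lambda>X Y. A ** matrix_inv (Q - mpow X (s / t) - adj B ** mpow Y (- p / t) ** B) ** adj A)"
  defines "Xs \<equiv> (\<lambda>k. fst (pair_iter F (scal a) (scal b) k))"
  defines "Ys \<equiv> (\<lambda>k. snd (pair_iter F (scal a) (scal b) k))"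
  defines "\<delta> \<equiv> 2 * max ((s / t) * (specnorm A)\<^sup>2 * \<theta> powr (-2) * a powr (s / t - 1))
                       ((p / t) * (specnorm A)\<^sup>2 * (specnorm B)\<^sup>2 * \<theta> powr (-2) * a powr (- p / t - 1))"
  assumes "a < b"
    and "loewner_le (scal (1 / b) ** (adj A ** A) + scal (b powr (s / t)) + scal (a powr (- p / t)) ** (adj B ** B)) Q"
    and "s * (specnorm A)\<^sup>2 < (1 / 2) * t * \<theta>\<^sup>2 * a powr (1 - s / t)"
    and "p * (specnorm B)\<^sup>2 < s * a powr ((p + s) / t)"
  shows "\<exists>Xb.
      \<comment> \<open>(I)\<close>
      Xb \<in> loewner_interval (scal a) (scal b) \<and> posdef Xb \<and>
      mpow Xb (s / t) + adj A ** matrix_inv Xb ** A + adj B ** mpow Xb (- p / t) ** B = Q \<and>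
      (\<forall>X \<in> loewner_interval (scal a) (scal b). posdef X \<and>
          mpow X (s / t) + adj A ** matrix_inv X ** A + adj B ** mpow X (- p / t) ** B = Q \<longrightarrow> X = Xb) \<and>
      F Xb Xb = Xb \<and>
      (\<forall>X \<in> loewner_interval (scal a) (scal b). F X X = X \<longrightarrow> X = Xb) \<and>
      \<comment> \<open>(II)\<close>
      Xb \<in> loewner_interval (F (scal a) (scal b)) (F (scal b) (scal a)) \<and>
      \<comment> \<open>(III)\<close>
      Xs \<longlonglongrightarrow> Xb \<and> Ys \<longlonglongrightarrow> Xb \<and> \<delta> < 1 \<and>
      (\<forall>k. max (specnorm (Xs k - Xb)) (specnorm (Ys k - Xb))
             \<le> \<delta> ^ k / (1 - \<delta>) * max (specnorm (Xs 1 - Xs 0)) (specnorm (Ys 1 - Ys 0))) \<and>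
      \<comment> \<open>consequence\<close>
      mpow Xb (1 / t) \<in> loewner_interval (scal (a powr (1 / t))) (scal (b powr (1 / t))) \<and>
      posdef (mpow Xb (1 / t)) \<and>
      mpow (mpow Xb (1 / t)) s + adj A ** mpow (mpow Xb (1 / t)) (- t) ** A
        + adj B ** mpow (mpow Xb (1 / t)) (- p) ** B = Q \<and>
      (\<forall>Z \<in> loewner_interval (scal (a powr (1 / t))) (scal (b powr (1 / t))). posdef Z \<and>
          mpow Z s + adj A ** mpow Z (- t) ** A + adj B ** mpow Z (- p) ** B = Q
          \<longrightarrow> Z = mpow Xb (1 / t))"
proof -
  define \<alpha> where "\<alpha> = s / t"
  define q where "q = - p / t"
  define G where "G X Y = Q - mpow X \<alpha> - adj B ** mpow Y q ** B" for X Y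
  define S where "S = loewner_interval (scal a :: complex^'n^'n) (scal b)"
  have F: "F X Y = A ** matrix_inv (G X Y) ** adj A" for X Y
    by (simp add: F_def G_def \<alpha>_def q_def)
  note A = \<open>invertible A\<close> and Q = \<open>posdef Q\<close> and b = \<open>0 < b\<close>
  have t: "0 < t" and s: "0 < s" and p: "0 < p" using assms(1-3) by auto
  \<comment> \<open>\<open>s \<le> t\<close> and \<open>p \<le> t\<close> put both exponents in the
    range of the Lipschitz bound for powers.\<close>
  have \<alpha>: "0 < \<alpha>" "\<alpha> \<le> 1" and q: "- 1 \<le> q" "q < 0"
    using assms(1-5) by (auto simp: \<alpha>_def q_def field_simps)
  have hQ: "hermitian Q" using Q by (simp add: posdef_def)
  have pdA: "posdef (adj A ** M ** A)" if "posdef M" for M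
    using posdef_sandwich[OF that invertible_adj[OF A]] by simp
  have pdQ: "posdef (A ** matrix_inv Q ** adj A)"
    using Q A by (simp add: posdef_sandwich matrix_inv_posdef posdef_mpow)
  then have a: "0 < a" unfolding a_def by (rule lambda_min_pos)
  have pdAA: "posdef (adj A ** A)"
    using pdA[OF posdef_scal[of 1]] by (simp add: scal_def)
  then have \<theta>: "0 < \<theta>" unfolding \<theta>_def using b by (simp add: lambda_min_pos)

  \<comment> \<open>Invariance of the order interval\<close>
  have S_posdef: "posdef X" if "X \<in> S" for X
    using that posdef_mono[OF posdef_scal[OF a]] by (auto simp: S_def loewner_interval_def)
  have S_bounds: "loewner_le (scal a) X" "loewner_le X (scal b)" if "X \<in> S" for X
    using that by (auto simp: S_def loewner_interval_def)
  note bounds = mpow_scal_bounds[OF S_posdef a S_bounds]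
  have aS: "scal a \<in> S" and bS: "scal b \<in> S"
    using \<open>a < b\<close> by (auto simp: S_def loewner_interval_def loewner_le_iff scal_mult_vec mult_right_mono)

  \<comment> \<open>The lower bound for \<open>G\<close> supplied by (ii), written with
    \<open>matrix_inv (scal b)\<close> so that \<open>matrix_inv_sandwich_cancel\<close> later
    evaluates its image as \<open>scal b\<close>.\<close>
  define L where "L = adj A ** matrix_inv (scal b) ** A"
  have L: "L = scal (1 / b) ** (adj A ** A)"
    using b by (simp add: L_def matrix_inv_scal scal_commute[of "adj A"] matrix_mul_assoc)
  have L_posdef: "posdef L"
    unfolding L_def using b by (simp add: pdA matrix_inv_scal posdef_scal)
  have hG: "hermitian (G X Y)" if "X \<in> S" "Y \<in> S" for X Y
    using hermitian_sandwich[of "mpow Y q" "adj B"] that hQ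
    by (simp add: G_def hermitian_diff hermitian_mpow S_posdef)
  have G_lower: "loewner_le L (G X Y)" if "X \<in> S" "Y \<in> S" for X Y
  proof -
    \<comment> \<open>Hypothesis (ii), to which the slack in replacing \<open>X\<close> by
      \<open>b\<close> and \<open>Y\<close> by \<open>a\<close> is added.\<close>
    have "psd (Q - (L + scal (b powr \<alpha>) + scal (a powr q) ** (adj B ** B)))"
      using assms(17) by (simp add: loewner_le_def L \<alpha>_def q_def)
    moreover have "psd (scal (b powr \<alpha>) - mpow X \<alpha>)"
      using bounds(2)[OF that(1) that(1)] that \<alpha> by (simp add: loewner_le_def)
    moreover have "psd (scal (a powr q) ** (adj B ** B) - adj B ** mpow Y q ** B)"
      using loewner_le_sandwich[OF bounds(4)[of Y q], of "adj B"] that q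
      by (simp add: loewner_le_def scal_commute[of "adj B"] matrix_mul_assoc)
    ultimately have "psd (Q - (L + scal (b powr \<alpha>) + scal (a powr q) ** (adj B ** B))
        + (scal (b powr \<alpha>) - mpow X \<alpha>) + (scal (a powr q) ** (adj B ** B) - adj B ** mpow Y q ** B))"
      by (intro psd_add)
    then show ?thesis by (simp add: loewner_le_def G_def algebra_simps)
  qed
  have G_posdef: "posdef (G X Y)" if "X \<in> S" "Y \<in> S" for X Y
    using posdef_mono[OF L_posdef G_lower hG] that by blast
  have G_upper: "loewner_le (G X Y) Q" if "X \<in> S" "Y \<in> S" for X Y
  proof -
    have "psd (mpow X \<alpha>)" "psd (adj B ** mpow Y q ** adj (adj B))"
      using that posdef_imp_psd[OF posdef_mpow[OF S_posdef]] psd_sandwich by blast+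
    then show ?thesis using psd_add[of "mpow X \<alpha>" "adj B ** mpow Y q ** B"]
      by (simp add: loewner_le_def G_def)
  qed
  \<comment> \<open>The assumptions compare powers because \<open>bounds\<close> yields such
    comparisons with scalar matrices directly.\<close>
  have G_antimono: "loewner_le (G X' Y') (G X Y)"
    if "X \<in> S" "Y \<in> S" "X' \<in> S" "Y' \<in> S"
      and "loewner_le (mpow X \<alpha>) (mpow X' \<alpha>)" "loewner_le (mpow Y q) (mpow Y' q)" for X Y X' Y'
  proof -
    have "psd (mpow X' \<alpha> - mpow X \<alpha>)" "psd (adj B ** mpow Y' q ** B - adj B ** mpow Y q ** B)"
      using that(5) loewner_le_sandwich[OF that(6), of "adj B"] by (simp_all add: loewner_le_def)
    from psd_add[OF this] show ?thesis by (simp add: loewner_le_def G_def algebra_simps)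
  qed
  have F_hermitian: "hermitian (F X Y)" if "X \<in> S" "Y \<in> S" for X Y
    using that by (simp add: F hermitian_sandwich matrix_inv_hermitian G_posdef)
  \<comment> \<open>Inversion and congruence by \<open>A\<close> turn
    \<open>L \<le> G \<le> Q\<close> into the two bounds: \<open>a\<close> is by definition the
    smallest eigenvalue of the image of \<open>Q\<close>, and the image of \<open>L\<close> is
    \<open>scal b\<close>.\<close>
  have F_in: "F X Y \<in> S" if "X \<in> S" "Y \<in> S" for X Y
  proof -
    have "loewner_le (A ** matrix_inv Q ** adj A) (F X Y)"
      unfolding F using that by (intro loewner_le_sandwich matrix_inv_antimono G_posdef G_upper Q)
    moreover have "loewner_le (scal a) (A ** matrix_inv Q ** adj A)"
      unfolding a_def using pdQ by (intro lambda_min_le) (simp add: posdef_def)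
    moreover have "loewner_le (F X Y) (A ** matrix_inv L ** adj A)"
      unfolding F using that by (intro loewner_le_sandwich matrix_inv_antimono G_posdef G_lower L_posdef)
    moreover have "A ** matrix_inv L ** adj A = scal b"
      unfolding L_def by (rule matrix_inv_sandwich_cancel[OF A posdef_invertible[OF posdef_scal[OF b]]])
    ultimately show ?thesis
      using loewner_le_trans F_hermitian[OF that] by (auto simp: S_def loewner_interval_def)
  qed

  \<comment> \<open>The contraction estimate\<close>
  have G_theta: "loewner_le (scal \<theta>) (G X Y)" if "X \<in> S" "Y \<in> S" for X Y
  proof -
    have hAA: "hermitian (adj A ** A)" using pdAA by (simp add: posdef_def)
    have "x \<bullet> (scal \<theta> *v x) \<le> x \<bullet> (L *v x)" for x
    proof -
      have "x \<bullet> (scal (lambda_min (adj A ** A)) *v x) \<le> x \<bullet> ((adj A ** A) *v x)"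
        using lambda_min_le[OF hAA] hAA by (simp add: loewner_le_iff)
      then show ?thesis using b
        by (simp add: L \<theta>_def scal_mult_vec divide_right_mono flip: matrix_vector_mul_assoc)
    qed
    then have "loewner_le (scal \<theta>) L"
      using L_posdef by (simp add: loewner_le_iff posdef_def)
    then show ?thesis using G_lower[OF that] loewner_le_trans by blast
  qed
  \<comment> \<open>\<open>k1\<close> and \<open>k2\<close> are the Lipschitz constants of
    \<open>F\<close> in its first and second argument.\<close>
  define k1 where "k1 = (s / t) * (specnorm A)\<^sup>2 * \<theta> powr (-2) * a powr (s / t - 1)"
  define k2 where "k2 = (p / t) * (specnorm A)\<^sup>2 * (specnorm B)\<^sup>2 * \<theta> powr (-2) * a powr (- p / t - 1)"
  have \<delta>: "\<delta> = 2 * max k1 k2" by (simp add: \<delta>_def k1_def k2_def)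
  have \<theta>2: "\<theta> powr (-2) = 1 / \<theta>\<^sup>2" using \<theta> by (simp add: powr_minus_divide)
  have k_nonneg: "0 \<le> k1" "0 \<le> k2" using s t p by (simp_all add: k1_def k2_def)
  have F_lipschitz: "specnorm (F X Y - F X' Y') \<le> \<delta> * max (specnorm (X - X')) (specnorm (Y - Y'))"
    if "X \<in> S" "Y \<in> S" "X' \<in> S" "Y' \<in> S" for X Y X' Y'
  proof -
    let ?x = "specnorm (X - X')" and ?y = "specnorm (Y - Y')"
    have "G X' Y' - G X Y = (mpow X \<alpha> - mpow X' \<alpha>) + adj B ** (mpow Y q - mpow Y' q) ** adj (adj B)"
      by (simp add: G_def matrix_diff_ldistrib matrix_diff_rdistrib)
    then have "specnorm (G X Y - G X' Y') \<le> specnorm (mpow X \<alpha> - mpow X' \<alpha>)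
        + (specnorm B)\<^sup>2 * specnorm (mpow Y q - mpow Y' q)"
      using specnorm_add[of "mpow X \<alpha> - mpow X' \<alpha>" "adj B ** (mpow Y q - mpow Y' q) ** adj (adj B)"]
        specnorm_sandwich[of "adj B" "mpow Y q - mpow Y' q"]
      by (simp add: specnorm_adj specnorm_diff_commute[of "G X Y"])
    also have "\<dots> \<le> \<bar>\<alpha>\<bar> * a powr (\<alpha> - 1) * ?x + (specnorm B)\<^sup>2 * (\<bar>q\<bar> * a powr (q - 1) * ?y)"
      using that \<alpha> q a
      by (intro add_mono mult_left_mono specnorm_mpow_diff_le S_posdef S_bounds) auto
    finally have G: "specnorm (G X Y - G X' Y') \<le>
        s / t * a powr (s / t - 1) * ?x + (specnorm B)\<^sup>2 * (p / t * a powr (- p / t - 1) * ?y)"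
      using s t p by (simp add: \<alpha>_def q_def)
    have "F X Y - F X' Y' = A ** (matrix_inv (G X Y) - matrix_inv (G X' Y')) ** adj A"
      by (simp add: F matrix_diff_ldistrib matrix_diff_rdistrib)
    then have "specnorm (F X Y - F X' Y') \<le> (specnorm A)\<^sup>2 * specnorm (matrix_inv (G X Y) - matrix_inv (G X' Y'))"
      by (simp only: specnorm_sandwich)
    also have "\<dots> \<le> (specnorm A)\<^sup>2 * (specnorm (G X Y - G X' Y') / \<theta>\<^sup>2)"
      using that \<theta> by (intro mult_left_mono specnorm_matrix_inv_diff_le G_posdef G_theta) auto
    also have "\<dots> \<le> (specnorm A)\<^sup>2 * ((s / t * a powr (s / t - 1) * ?x
        + (specnorm B)\<^sup>2 * (p / t * a powr (- p / t - 1) * ?y)) / \<theta>\<^sup>2)"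
      by (intro mult_left_mono divide_right_mono G) auto
    also have "\<dots> = k1 * ?x + k2 * ?y"
      using \<theta> t by (simp add: k1_def k2_def \<theta>2 field_simps)
    \<comment> \<open>The sum of the two contributions produces the factor 2 in
      \<open>\<delta>\<close>.\<close>
    also have "\<dots> \<le> max k1 k2 * max ?x ?y + max k1 k2 * max ?x ?y"
      using k_nonneg by (intro add_mono mult_mono) (auto simp: specnorm_nonneg)
    finally show ?thesis by (simp add: \<delta>)
  qed
  \<comment> \<open>This is (iii) divided through by its positive factors.\<close>
  have k1_less: "k1 < 1 / 2"
  proof -
    have "a powr (s / t - 1) * a powr (1 - s / t) = 1"
      using a by (simp add: powr_add[symmetric])
    then have "k1 = s * (specnorm A)\<^sup>2 / (t * \<theta>\<^sup>2 * a powr (1 - s / t))"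
      using a \<theta> t by (simp add: k1_def \<theta>2 field_simps)
    then show ?thesis
      using assms(18) a \<theta> t by (simp add: divide_less_eq mult_ac)
  qed
  \<comment> \<open>By (iv), \<open>p * (specnorm B)\<^sup>2\<close> may be replaced by
    \<open>s * a powr ((p + s) / t)\<close>; the powers of \<open>a\<close> then combine to the one
    in \<open>k1\<close>.\<close>
  have "k2 \<le> k1"
  proof -
    have "(p + s) / t + (- p / t - 1) = s / t - 1" using t by (simp add: field_simps)
    then have e: "a powr ((p + s) / t) * a powr (- p / t - 1) = a powr (s / t - 1)"
      by (simp only: powr_add[symmetric])
    have "k2 = (p * (specnorm B)\<^sup>2) * ((specnorm A)\<^sup>2 * \<theta> powr (-2) * a powr (- p / t - 1) / t)"
      by (simp add: k2_def)
    also have "\<dots> \<le> (s * a powr ((p + s) / t)) * ((specnorm A)\<^sup>2 * \<theta> powr (-2) * a powr (- p / t - 1) / t)"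
      using assms(19) t by (intro mult_right_mono) auto
    also have "\<dots> = k1" by (simp add: k1_def e[symmetric] mult_ac)
    finally show ?thesis .
  qed
  with k1_less have \<delta>1: "\<delta> < 1" by (simp add: \<delta>)

  \<comment> \<open>The fixed point and its properties\<close>
  obtain K where K: "\<And>M :: complex^'n^'n. specnorm M \<le> K * norm M"
    using specnorm_le_norm by blast
  interpret coupled_contraction F specnorm S "(real CARD('n))\<^sup>2" K \<delta> "scal a" "scal b"
    by unfold_locales
       (use F_in F_lipschitz K \<delta>1 k_nonneg aS bS in \<open>auto simp: specnorm_nonneg specnorm_add norm_le_specnorm
          \<delta> le_max_iff_disj S_def closed_loewner_interval intro: specnorm_diff_commute\<close>)
  have Xs: "Xs = X" and Ys: "Ys = Y"
    by (simp_all add: Xs_def Ys_def X_def Y_def fun_eq_iff)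
  obtain Xb where Xb: "Xb \<in> S" "F Xb Xb = Xb" and lim: "X \<longlonglongrightarrow> Xb" "Y \<longlonglongrightarrow> Xb"
    by (rule fixed_point)
  \<comment> \<open>Rearranged, the equation says that \<open>G X X\<close> equals
    \<open>adj A ** matrix_inv X ** A\<close>; the cancellation lemma for \<open>A\<close> and for
    \<open>adj A\<close> gives the two directions.\<close>
  have eq_iff: "mpow X (s / t) + adj A ** matrix_inv X ** A + adj B ** mpow X (- p / t) ** B = Q
      \<longleftrightarrow> F X X = X" if "X \<in> S" for X
  proof
    assume "mpow X (s / t) + adj A ** matrix_inv X ** A + adj B ** mpow X (- p / t) ** B = Q"
    then have "G X X = adj A ** matrix_inv X ** A"
      unfolding G_def \<alpha>_def q_def by (simp add: algebra_simps)
    then show "F X X = X"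
      unfolding F using matrix_inv_sandwich_cancel[OF A posdef_invertible[OF S_posdef[OF that]]] by simp
  next
    assume "F X X = X"
    then have "adj A ** matrix_inv X ** A = G X X"
      using matrix_inv_sandwich_cancel[OF invertible_adj[OF A] posdef_invertible[OF G_posdef[OF that that]]]
      by (simp add: F)
    then show "mpow X (s / t) + adj A ** matrix_inv X ** A + adj B ** mpow X (- p / t) ** B = Q"
      unfolding G_def \<alpha>_def q_def by (simp add: algebra_simps)
  qed
  have uniq: "X = Xb" if "X \<in> S" "F X X = X" for X
    using fixed_point_unique[OF Xb that] .
  have pdXb: "posdef Xb" using Xb S_posdef by blast
  have II: "Xb \<in> loewner_interval (F (scal a) (scal b)) (F (scal b) (scal a))"
  proof -
    note Xb_bounds = bounds(1,2)[OF Xb(1) Xb(1) Xb(1), of \<alpha>] bounds(3,4)[OF Xb(1) Xb(1) Xb(1), of q]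
    \<comment> \<open>The first argument is compared through the increasing power and the second
      through the decreasing one, so \<open>a\<close> and \<open>b\<close> occur in opposite
      positions.\<close>
    have "loewner_le (G Xb Xb) (G (scal a) (scal b))" "loewner_le (G (scal b) (scal a)) (G Xb Xb)"
      using Xb_bounds a b \<alpha> q by (auto intro!: G_antimono aS bS Xb simp: mpow_scal)
    then have "loewner_le (F (scal a) (scal b)) (F Xb Xb)" "loewner_le (F Xb Xb) (F (scal b) (scal a))"
      unfolding F by (auto intro!: loewner_le_sandwich matrix_inv_antimono G_posdef aS bS Xb)
    then show ?thesis using pdXb by (simp add: loewner_interval_def Xb posdef_def)
  qed
  \<comment> \<open>Substituting the \<open>1 / t\<close> power: the exponents multiply to
    \<open>s / t\<close>, \<open>-1\<close> and \<open>- p / t\<close>.\<close>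
  have root: "mpow (mpow Xb (1 / t)) s + adj A ** mpow (mpow Xb (1 / t)) (- t) ** A
        + adj B ** mpow (mpow Xb (1 / t)) (- p) ** B = Q"
    using eq_iff[OF Xb(1)] Xb(2) t by (simp add: mpow_mpow pdXb matrix_inv_posdef)
  have root_in: "mpow Xb (1 / t) \<in> loewner_interval (scal (a powr (1 / t))) (scal (b powr (1 / t)))"
    using bounds(1,2)[OF Xb(1) Xb(1) Xb(1), of "1 / t"] t by (simp add: loewner_interval_def hermitian_mpow pdXb)
  have root_uniq: "Z = mpow Xb (1 / t)"
    if Z: "Z \<in> loewner_interval (scal (a powr (1 / t))) (scal (b powr (1 / t)))" "posdef Z"
      and eq: "mpow Z s + adj A ** mpow Z (- t) ** A + adj B ** mpow Z (- p) ** B = Q" for Z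
  proof -
    have "0 < a powr (1 / t)" using a by simp
    \<comment> \<open>Uniqueness is pulled back along the power \<open>t\<close>, whose scalar
      bounds return exactly \<open>a\<close> and \<open>b\<close>.\<close>
    then have "mpow Z t \<in> S"
      using mpow_scal_bounds(1,2)[OF Z(2), of "a powr (1 / t)" "b powr (1 / t)" t] Z a b t
      by (simp add: S_def loewner_interval_def hermitian_mpow powr_powr)
    moreover from this have "F (mpow Z t) (mpow Z t) = mpow Z t"
      using eq t by (simp add: eq_iff[symmetric] matrix_inv_mpow mpow_mpow Z)
    ultimately have "mpow Z t = Xb" by (rule uniq)
    then show ?thesis using t by (auto simp: mpow_mpow mpow_1 Z)
  qed
  show ?thesis
    unfolding S_def[symmetric] Xs Ys
  proof (intro exI[of _ Xb] conjI allI ballI impI)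
    show "mpow Xb (s / t) + adj A ** matrix_inv Xb ** A + adj B ** mpow Xb (- p / t) ** B = Q"
      using eq_iff Xb by blast
    show "M = Xb" if "M \<in> S" "posdef M \<and>
        mpow M (s / t) + adj A ** matrix_inv M ** A + adj B ** mpow M (- p / t) ** B = Q" for M
      using that eq_iff uniq by blast
    show "Z = mpow Xb (1 / t)" if "Z \<in> loewner_interval (scal (a powr (1 / t))) (scal (b powr (1 / t)))"
      "posdef Z \<and> mpow Z s + adj A ** mpow Z (- t) ** A + adj B ** mpow Z (- p) ** B = Q" for Z
      using that root_uniq by blast
  qed (fact Xb pdXb II lim \<delta>1 root root_in error_bound[OF Xb] posdef_mpow[OF pdXb] | erule (1) uniq)+
qed

end
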